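(* Let $(\mathcal{K}_q)_{q\ge1}$ be a consistent multiplicative sequence that satisfies the Johnsen-Gallagher condition, let $g$ be the associated function (see the context) and put $L(D)=\sum_{q\le D}g(q)$. Assume that there are constants $C>0$, $\kappa\ge1$ and a real number $c_0$ such that, as $D\to\infty$, $$L(D)=C\bigl((\log D)^\kappa+(c_0+o(1))(\log D)^{\kappa-1}\bigr),$$ and that, for all $D\ge1$, $$\sum_{\substack{p\ge2,\ \nu\ge1\\ p^\nu\le D}}p^\nu g(p^\nu)\log(p^\nu)=\kappa D+O\bigl(D/\log(2D)\bigr),$$ $$\sum_{p\ge2}\ \sum_{\substack{\nu,k\ge1\\ p^{\nu+k}\le D}}p^{k+\nu}g(p^k)g(p^\nu)\log(p^\nu)\ll\sqrt D,$$ where $p$ runs over primes. Then there exists $N_0$ (depending on $(\mathcal{K}_q)_{q\ge1}$ and on the data in the hypotheses) such that for every integer $N\ge N_0$, every integer $M$, and every set of integers $\mathcal{Z}\subset[M,M+N]$ having support on $(\mathcal{K}_q)_{q\le Q}$ for all $Q\le\pi\sqrt N/2$, we have $$|\mathcal{Z}|\le\frac{2^\kappa N}{C\bigl((\log N)^\kappa+2(c_0-0.238\,\kappa)(\log N)^{\kappa-1}\bigr)}.$$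
   Context: For every positive integer $q$, $\mathcal{K}_q$ is a non-empty subset of $\mathbb{Z}/q\mathbb{Z}$ (so $\mathcal{K}_1=\mathbb{Z}/1\mathbb{Z}$). The sequence $(\mathcal{K}_q)$ is multiplicative if, whenever $q=p_1^{e_1}\cdots p_r^{e_r}$ with distinct primes $p_i$, the set $\mathcal{K}_q$ corresponds to $\prod_{i}\mathcal{K}_{p_i^{e_i}}$ under the Chinese Remainder isomorphism $\mathbb{Z}/q\mathbb{Z}\to\prod_i\mathbb{Z}/p_i^{e_i}\mathbb{Z}$. It is consistent if, whenever $d\mid q$, the image of $\mathcal{K}_q$ under reduction modulo $d$ is $\mathcal{K}_d$. It satisfies the Johnsen-Gallagher condition if for all $q$, all $d\mid q$ and all $y\in\mathcal{K}_d$, one has $\#\{x\in\mathcal{K}_q: x\equiv y \bmod d\}=|\mathcal{K}_q|/|\mathcal{K}_d|$. A set $\mathcal{Z}$ of integers has support on $(\mathcal{K}_q)_{q\le Q}$ if, for every $n\in\mathcal{Z}$ and every $q\le Q$, the class of $n$ modulo $q$ belongs to $\mathcal{K}_q$. The function $g$ is $$g(q)=\prod_{p^\alpha\|q}\Bigl(\frac{p^\alpha}{|\mathcal{K}_{p^\alpha}|}-\frac{p^{\alpha-1}}{|\mathcal{K}_{p^{\alpha-1}}|}\Bigr).$$ *)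

theory Defs
  imports Complex_Main "HOL-Library.FuncSet" "HOL-Library.Landau_Symbols"
    "HOL-Computational_Algebra.Primes"
begin

text \<open>
  The ring of integers modulo \<open>q\<close> is represented by the least non-negative residues
  \<open>{0..<int q}\<close>, and reduction modulo \<open>d\<close> by \<open>\<lambda>x. x mod int d\<close>.
  Only the values \<open>K q\<close> with \<open>q \<ge> 1\<close> are meaningful; \<open>K 0\<close> is never used.
\<close>

definition residue_sets :: "(nat \<Rightarrow> int set) \<Rightarrow> bool" where
  "residue_sets K \<longleftrightarrow> (\<forall>q\<ge>1. K q \<subseteq> {0..<int q} \<and> K q \<noteq> {})"

definition prime_part :: "nat \<Rightarrow> nat \<Rightarrow> nat" where
  "prime_part q p = p ^ multiplicity p q"

text \<open>
  The Chinese Remainder isomorphism; its target is the extensional dependent product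
  of the residues modulo \<open>p ^ multiplicity p q\<close>, for \<open>p\<close> ranging over the prime
  factors of \<open>q\<close>.
\<close>

definition crt_map :: "nat \<Rightarrow> int \<Rightarrow> (nat \<Rightarrow> int)" where
  "crt_map q x = (\<lambda>p\<in>prime_factors q. x mod int (prime_part q p))"

definition multiplicative_sets :: "(nat \<Rightarrow> int set) \<Rightarrow> bool" where
  "multiplicative_sets K \<longleftrightarrow>
     (\<forall>q\<ge>1. crt_map q ` K q = (\<Pi>\<^sub>E p\<in>prime_factors q. K (prime_part q p)))"

definition consistent_sets :: "(nat \<Rightarrow> int set) \<Rightarrow> bool" where
  "consistent_sets K \<longleftrightarrow>
     (\<forall>q\<ge>1. \<forall>d. d dvd q \<longrightarrow> (\<lambda>x. x mod int d) ` K q = K d)"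

definition johnsen_gallagher :: "(nat \<Rightarrow> int set) \<Rightarrow> bool" where
  "johnsen_gallagher K \<longleftrightarrow>
     (\<forall>q\<ge>1. \<forall>d. d dvd q \<longrightarrow> (\<forall>y\<in>K d.
        real (card {x \<in> K q. x mod int d = y}) = real (card (K q)) / real (card (K d))))"

definition has_support :: "(nat \<Rightarrow> int set) \<Rightarrow> real \<Rightarrow> int set \<Rightarrow> bool" where
  "has_support K Q Z \<longleftrightarrow>
     (\<forall>n\<in>Z. \<forall>q::nat. 1 \<le> q \<and> real q \<le> Q \<longrightarrow> n mod int q \<in> K q)"

definition sieve_g :: "(nat \<Rightarrow> int set) \<Rightarrow> nat \<Rightarrow> real" where
  "sieve_g K q = (\<Prod>p\<in>prime_factors q. let a = multiplicity p q in
     real (p ^ a) / real (card (K (p ^ a))) - real (p ^ (a - 1)) / real (card (K (p ^ (a - 1)))))"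

definition sieve_L :: "(nat \<Rightarrow> int set) \<Rightarrow> real \<Rightarrow> real" where
  "sieve_L K D = (\<Sum>q | 1 \<le> q \<and> real q \<le> D. sieve_g K q)"

definition prime_power_sum :: "(nat \<Rightarrow> int set) \<Rightarrow> real \<Rightarrow> real" where
  "prime_power_sum K D =
     (\<Sum>(p, \<nu>) \<in> {(p::nat, \<nu>::nat). prime p \<and> 1 \<le> \<nu> \<and> real (p ^ \<nu>) \<le> D}.
        real (p ^ \<nu>) * sieve_g K (p ^ \<nu>) * ln (real (p ^ \<nu>)))"

definition prime_power_pair_sum :: "(nat \<Rightarrow> int set) \<Rightarrow> real \<Rightarrow> real" where
  "prime_power_pair_sum K D =
     (\<Sum>(p, \<nu>, k) \<in> {(p::nat, \<nu>::nat, k::nat).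
          prime p \<and> 1 \<le> \<nu> \<and> 1 \<le> k \<and> real (p ^ (\<nu> + k)) \<le> D}.
        real (p ^ (k + \<nu>)) * sieve_g K (p ^ k) * sieve_g K (p ^ \<nu>) * ln (real (p ^ \<nu>)))"

end

theory Submission
  imports Defs "HOL-Analysis.Analysis" "HOL-Number_Theory.Cong" "HOL-Real_Asymp.Real_Asymp"
begin

text \<open>
  Let \<open>S\<close> be the exponential sum over \<open>Z\<close>, \<open>P = |Z|\<close> and \<open>Q = U sqrt N\<close>. The local
  inequality \<open>g(q) |S(b)|\<^sup>2 \<le> \<Sum>\<^sub>a |S(a/q + b)|\<^sup>2\<close> (\<open>a\<close> running over the reduced residues modulo
  \<open>q\<close>) holds for every real shift \<open>b\<close>, not only for \<open>b = 0\<close>. Since the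
  arcs of radius \<open>1/(2qQ)\<close> around the reduced fractions \<open>a/q\<close> with \<open>q \<le> Q\<close> are disjoint modulo 1,
  Parseval's identity yields \<open>\<Sum>\<^sub>q g(q) A(q) \<le> P\<close>, where \<open>A(q)\<close> is the integral of
  \<open>|S|\<^sup>2\<close> over \<open>[-1/(2qQ), 1/(2qQ)]\<close>.

  Lower bounds for \<open>A(q)\<close> come from comparing \<open>S\<close> with the sum \<open>T\<close> over the surrounding
  interval, multiplied by \<open>P/N\<close>. Positivity gives \<open>A(q) \<ge> (P\<^sup>2/N) (1 - o(1))\<close> as \<open>q/sqrt N\<close> tends to 0.
  If \<open>A(q)\<close> exceeds \<open>P\<^sup>2/N\<close> by a fixed factor for some \<open>q\<close> of the order of a small multiple of \<open>sqrt N\<close>,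
  then so it does for all smaller \<open>q\<close>, and these carry all but a proportion
  \<open>O(1/log N)\<close> of the sum of \<open>g\<close>. Otherwise \<open>S\<close> is close in mean square to
  \<open>(P/N) T\<close> on the shorter arcs, so that \<open>A(q)\<close> is at least about
  \<open>(P\<^sup>2/N) (1 - 2cUq/sqrt N)\<close> with \<open>c = 0.143\<close>. Summing against \<open>g\<close>, the constant
  \<open>c\<^sub>0\<close> is diminished by \<open>\<kappa> (2cU\<^sup>2 - ln U)\<close>, which is less than \<open>0.221 \<kappa>\<close> for \<open>U = 4/3\<close>.
\<close>

subsection \<open>The local inequality at shifted frequencies\<close>

definition expsum :: "int set \<Rightarrow> real \<Rightarrow> complex" where
  "expsum Z x = (\<Sum>n\<in>Z. cis (2 * pi * of_int n * x))"

text \<open>For \<open>q = 1\<close> the set is \<open>{0}\<close>, because 0 is coprime to 1; so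
  the arc around the fraction 0 enters exactly once.\<close>

definition reduced :: "nat \<Rightarrow> nat set" where
  "reduced q = {a. a < q \<and> coprime a q}"

lemma finite_reduced [simp]: "finite (reduced q)"
  unfolding reduced_def by simp

lemma cis_of_int_multiple: "cis (2 * pi * of_int k) = 1"
  by (simp add: complex_eq_iff)

lemma expsum_add_int: "expsum Z (x + of_int k) = expsum Z x"
proof -
  have "cis (2 * pi * of_int n * (x + of_int k)) = cis (2 * pi * of_int n * x)" for n :: int
  proof -
    have "cis (2 * pi * of_int n * (x + of_int k))
        = cis (2 * pi * of_int n * x) * cis (2 * pi * of_int (n * k))"
      by (simp add: cis_mult algebra_simps)
    then show ?thesis by (simp only: cis_of_int_multiple) simp
  qed
  then show ?thesis unfolding expsum_def by simp
qed

lemma sum_cis_orthogonal: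
  assumes "d > 0"
  shows "(\<Sum>a<d. cis (2 * pi * of_int k * (real a / real d))) = (if int d dvd k then of_nat d else 0)"
proof -
  define w where "w = cis (2 * pi * of_int k / real d)"
  have pow: "cis (2 * pi * of_int k * (real a / real d)) = w ^ a" for a
    unfolding w_def Complex.DeMoivre by (rule arg_cong[where f = cis]) simp
  show ?thesis
  proof (cases "int d dvd k")
    case True
    then obtain m where "k = int d * m" by auto
    then have "w = 1"
      unfolding w_def using assms cis_of_int_multiple[of m] by (simp add: field_simps)
    then show ?thesis using True by (simp only: pow) simp
  next
    case False
    have "w \<noteq> 1"
    proof
      assume "w = 1"
      then have "cos (2 * pi * of_int k / real d) = 1"
        unfolding w_def by (metis Re_complex_of_real cis.sel(1) of_real_1)
      then obtain m :: int where "2 * pi * of_int k / real d = of_int m * 2 * pi"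
        using cos_one_2pi_int by blast
      then have "(of_int k :: real) = of_int (m * int d)"
        using assms by (simp add: field_simps)
      then have "k = m * int d" using of_int_eq_iff by blast
      then show False using False by simp
    qed
    moreover have "w ^ d = 1"
      unfolding w_def using assms cis_of_int_multiple[of k] by (simp add: Complex.DeMoivre)
    ultimately have "(\<Sum>a<d. w ^ a) = 0" by (simp add: geometric_sum)
    then show ?thesis using False by (simp only: pow) simp
  qed
qed

lemma norm_expsum_sq: "of_real ((norm (expsum Z x))\<^sup>2)
   = (\<Sum>n\<in>Z. \<Sum>m\<in>Z. cis (2 * pi * of_int (n - m) * x))"
proof -
  have "of_real ((norm (expsum Z x))\<^sup>2) = expsum Z x * cnj (expsum Z x)"
    by (simp add: complex_norm_square[symmetric])
  also have "\<dots> = (\<Sum>n\<in>Z. \<Sum>m\<in>Z. cis (2 * pi * of_int (n - m) * x))"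
    unfolding expsum_def sum_distrib_left sum_distrib_right cnj_sum
    by (subst sum.swap) (simp add: cis_cnj cis_mult algebra_simps)
  finally show ?thesis .
qed

text \<open>Expanding the square leaves a sum over pairs, and summing over \<open>a\<close> kills
  all pairs that are not congruent modulo \<open>d\<close>. The shift \<open>b\<close> multiplies
  each pair by a factor free of \<open>a\<close>, so it passes unchanged into the class
  sums.\<close>

lemma expsum_parseval_mod:
  assumes "finite Z" "d > 0"
  shows "(\<Sum>a<d. (norm (expsum Z (real a / real d + b)))\<^sup>2)
       = real d * (\<Sum>y\<in>{0..<int d}. (norm (expsum {n\<in>Z. n mod int d = y} b))\<^sup>2)"
proof -
  let ?c = "\<lambda>n m. cis (2 * pi * of_int (n - m) * b)"
  have "of_real (\<Sum>a<d. (norm (expsum Z (real a / real d + b)))\<^sup>2)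
     = (\<Sum>a<d. \<Sum>n\<in>Z. \<Sum>m\<in>Z. ?c n m * cis (2 * pi * of_int (n - m) * (real a / real d)))"
    unfolding of_real_sum norm_expsum_sq
    by (intro sum.cong refl) (simp add: cis_mult algebra_simps)
  also have "\<dots> = (\<Sum>n\<in>Z. \<Sum>m\<in>Z. \<Sum>a<d. ?c n m * cis (2 * pi * of_int (n - m) * (real a / real d)))"
    by (subst sum.swap, rule sum.cong[OF refl], subst sum.swap, rule refl)
  also have "\<dots> = (\<Sum>n\<in>Z. \<Sum>m\<in>Z. if m mod int d = n mod int d then of_nat d * ?c n m else 0)"
    unfolding sum_distrib_left[symmetric] sum_cis_orthogonal[OF assms(2)]
    by (intro sum.cong refl) (auto simp: mod_eq_dvd_iff dvd_diff_commute)
  also have "\<dots> = of_nat d * (\<Sum>n\<in>Z. \<Sum>m\<in>{m\<in>Z. m mod int d = n mod int d}. ?c n m)"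
    unfolding sum_distrib_left
    by (rule sum.cong[OF refl], rule sum.inter_filter[OF assms(1), symmetric])
  also have "(\<Sum>n\<in>Z. \<Sum>m\<in>{m\<in>Z. m mod int d = n mod int d}. ?c n m)
     = (\<Sum>y\<in>{0..<int d}. \<Sum>n\<in>{n\<in>Z. n mod int d = y}. \<Sum>m\<in>{m\<in>Z. m mod int d = n mod int d}. ?c n m)"
    by (rule sum.group[symmetric]) (use assms in auto)
  also have "\<dots> = (\<Sum>y\<in>{0..<int d}. of_real ((norm (expsum {n\<in>Z. n mod int d = y} b))\<^sup>2))"
    unfolding norm_expsum_sq by (intro sum.cong refl) auto
  also have "of_nat d * \<dots> = (of_real (real d * (\<Sum>y\<in>{0..<int d}.
      (norm (expsum {n\<in>Z. n mod int d = y} b))\<^sup>2)) :: complex)"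
    by simp
  finally show ?thesis by (simp only: of_real_eq_iff)
qed

lemma norm_sum_sq_le_card:
  fixes f :: "'a \<Rightarrow> complex"
  shows "(norm (sum f A))\<^sup>2 \<le> real (card A) * (\<Sum>x\<in>A. (norm (f x))\<^sup>2)"
proof -
  have "(norm (sum f A))\<^sup>2 \<le> (\<Sum>x\<in>A. 1 * norm (f x))\<^sup>2"
    by (intro power_mono) (auto simp: norm_sum)
  also have "\<dots> \<le> (\<Sum>x\<in>A. 1\<^sup>2) * (\<Sum>x\<in>A. (norm (f x))\<^sup>2)"
    by (rule Cauchy_Schwarz_ineq_sum)
  finally show ?thesis by simp
qed

lemma expsum_fibres:
  assumes "finite Z" "finite A" "\<And>n. n \<in> Z \<Longrightarrow> f n \<in> A"
  shows "expsum Z b = (\<Sum>x\<in>A. expsum {n\<in>Z. f n = x} b)"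
  unfolding expsum_def by (rule sum.group[symmetric]) (use assms in auto)

lemma sieve_g_prime_power:
  assumes "prime p" "k \<ge> 1"
  shows "sieve_g K (p ^ k) = real (p ^ k) / real (card (K (p ^ k)))
           - real (p ^ (k - 1)) / real (card (K (p ^ (k - 1))))"
  using assms
  by (simp add: sieve_g_def prime_factorization_prime_power Let_def)


text \<open>On a fibre of reduction modulo \<open>d\<close> the quotient \<open>x div int d\<close>
  determines \<open>x\<close> and takes at most \<open>p\<close> values. The bound is what makes the
  sieve weights nonnegative.\<close>

lemma card_fibre_le:
  assumes "A \<subseteq> {0..<int (p * d)}" "d > 0"
  shows "card {x\<in>A. x mod int d = y} \<le> p"
proof -
  have "inj_on (\<lambda>x. x div int d) {x\<in>A. x mod int d = y}"
    by (rule inj_onI) (metis (mono_tags, lifting) mem_Collect_eq mult_div_mod_eq)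
  moreover have "(\<lambda>x. x div int d) ` {x\<in>A. x mod int d = y} \<subseteq> {0..<int p}"
  proof
    fix z assume "z \<in> (\<lambda>x. x div int d) ` {x\<in>A. x mod int d = y}"
    then obtain x where x: "x \<in> A" "z = x div int d" by auto
    then have "0 \<le> x" "x < int p * int d" using assms(1) by auto
    moreover have "int d * (x div int d) \<le> x"
      using assms(2) mult_div_mod_eq[of "int d" x] pos_mod_sign[of "int d" x] by linarith
    ultimately have "int d * (x div int d) < int d * int p" by (simp add: mult.commute)
    then have "x div int d < int p" using assms(2) by simp
    then show "z \<in> {0..<int p}"
      using x \<open>0 \<le> x\<close> assms(2) by (auto simp: pos_imp_zdiv_nonneg_iff)
  qed
  ultimately have "card {x\<in>A. x mod int d = y} \<le> card {0..<int p}"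
    by (metis card_inj_on_le finite_atLeastLessThan_int)
  then show ?thesis by simp
qed

text \<open>A residue below \<open>p ^ k\<close> that is not reduced is a multiple of
  \<open>p\<close>, and cancelling that \<open>p\<close> turns the fraction into one with
  denominator \<open>p ^ (k - 1)\<close>.\<close>

lemma sum_reduced_prime_power:
  fixes f :: "real \<Rightarrow> real"
  assumes "prime p" "k \<ge> 1"
  shows "(\<Sum>a\<in>reduced (p ^ k). f (real a / real (p ^ k)))
       = (\<Sum>a<p ^ k. f (real a / real (p ^ k)))
         - (\<Sum>a<p ^ (k - 1). f (real a / real (p ^ (k - 1))))"
proof -
  have p0: "p > 0" using assms(1) prime_gt_0_nat by blast
  have pk: "p ^ k = p * p ^ (k - 1)" using assms(2) by (simp add: power_eq_if)
  have "{..<p ^ k} = reduced (p ^ k) \<union> (*) p ` {..<p ^ (k - 1)}"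
  proof (intro equalityI subsetI)
    fix a assume "a \<in> {..<p ^ k}"
    then have a: "a < p ^ k" by simp
    show "a \<in> reduced (p ^ k) \<union> (*) p ` {..<p ^ (k - 1)}"
    proof (cases "p dvd a")
      case True
      then obtain c where "a = p * c" by auto
      moreover from this a pk p0 have "c < p ^ (k - 1)" by simp
      ultimately show ?thesis by auto
    next
      case False
      then have "coprime a (p ^ k)"
        using assms(1) by (meson coprime_commute coprime_power_left_iff prime_imp_coprime_nat)
      then show ?thesis using a by (simp add: reduced_def)
    qed
  next
    fix a assume "a \<in> reduced (p ^ k) \<union> (*) p ` {..<p ^ (k - 1)}"
    then show "a \<in> {..<p ^ k}" using pk p0 by (auto simp: reduced_def)
  qed
  moreover have "reduced (p ^ k) \<inter> (*) p ` {..<p ^ (k - 1)} = {}"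
    using assms by (auto simp: reduced_def)
  ultimately have "(\<Sum>a<p ^ k. f (real a / real (p ^ k)))
     = (\<Sum>a\<in>reduced (p ^ k). f (real a / real (p ^ k)))
       + (\<Sum>a\<in>(*) p ` {..<p ^ (k - 1)}. f (real a / real (p ^ k)))"
    by (simp add: sum.union_disjoint)
  also have "(\<Sum>a\<in>(*) p ` {..<p ^ (k - 1)}. f (real a / real (p ^ k)))
     = (\<Sum>a<p ^ (k - 1). f (real a / real (p ^ (k - 1))))"
    by (subst sum.reindex) (use p0 pk in \<open>auto simp: inj_on_def\<close>)
  finally show ?thesis by simp
qed

text \<open>
  For a prime power the reduced residues carry the difference of two full sums of squares, and
  the Johnsen-Gallagher condition is what makes Cauchy-Schwarz on the fibres give the
  factor of \<^const>\<open>sieve_g\<close>.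
\<close>

lemma sieve_g_prime_power_bound:
  assumes K: "residue_sets K" "consistent_sets K" "johnsen_gallagher K"
    and p: "prime p" and k: "k \<ge> 1" and Z: "finite Z"
    and supp: "\<And>n. n \<in> Z \<Longrightarrow> n mod int (p ^ k) \<in> K (p ^ k)"
  shows "sieve_g K (p ^ k) \<ge> 0"
    and "sieve_g K (p ^ k) * (norm (expsum Z b))\<^sup>2
       \<le> (\<Sum>a\<in>reduced (p ^ k). (norm (expsum Z (real a / real (p ^ k) + b)))\<^sup>2)"
proof -
  define q d where "q = p ^ k" and "d = p ^ (k - 1)"
  have q: "q = p * d" unfolding q_def d_def using k by (simp add: power_eq_if)
  have pos: "p > 0" "q > 0" "d > 0" using p prime_gt_0_nat by (auto simp: q_def d_def)
  have dq: "d dvd q" by (simp add: q)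
  define F where "F m y = expsum {n\<in>Z. n mod int m = y} b" for m y
  have Kfin: "finite (K m)" "card (K m) > 0" "K m \<subseteq> {0..<int m}" if "m > 0" for m
  proof -
    show sub: "K m \<subseteq> {0..<int m}" using K(1) that unfolding residue_sets_def by auto
    then show fin: "finite (K m)" by (rule finite_subset) simp
    show "card (K m) > 0" using K(1) that fin unfolding residue_sets_def by (auto simp: card_gt_0_iff)
  qed
  have proj: "(\<lambda>x. x mod int d) ` K q = K d"
    using K(2) pos dq unfolding consistent_sets_def by auto
  have suppd: "n mod int d \<in> K d" if "n \<in> Z" for n
  proof -
    have "n mod int q mod int d \<in> K d" using supp[OF that] proj by (auto simp: q_def)
    then show ?thesis using dq by (simp add: mod_mod_cancel)
  qed
  have jg: "real (card {x\<in>K q. x mod int d = y}) = real (card (K q)) / real (card (K d))"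
    if "y \<in> K d" for y
    using K(3) pos dq that unfolding johnsen_gallagher_def by auto
  have full: "(\<Sum>a<m. (norm (expsum Z (real a / real m + b)))\<^sup>2) = real m * (\<Sum>y\<in>K m. (norm (F m y))\<^sup>2)"
    if "m > 0" "\<And>n. n \<in> Z \<Longrightarrow> n mod int m \<in> K m" for m
  proof -
    have "(\<Sum>y\<in>{0..<int m}. (norm (F m y))\<^sup>2) = (\<Sum>y\<in>K m. (norm (F m y))\<^sup>2)"
    proof (intro sum.mono_neutral_right ballI)
      show "K m \<subseteq> {0..<int m}" using Kfin(3)[OF that(1)] .
      fix y assume "y \<in> {0..<int m} - K m"
      then have "{n\<in>Z. n mod int m = y} = {}" using that(2) by auto
      then show "(norm (F m y))\<^sup>2 = 0" unfolding F_def expsum_def by (simp only:) simp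
    qed auto
    then show ?thesis using expsum_parseval_mod[OF Z that(1), of b] unfolding F_def by simp
  qed
  define X Y where "X = (\<Sum>x\<in>K q. (norm (F q x))\<^sup>2)" and "Y = (\<Sum>y\<in>K d. (norm (F d y))\<^sup>2)"
  have Y0: "Y \<ge> 0" unfolding Y_def by (simp add: sum_nonneg)
  have kq: "real (card (K q)) > 0" and kd: "real (card (K d)) > 0"
    using Kfin(2) pos by auto
  have g: "sieve_g K q = real q / real (card (K q)) - real d / real (card (K d))"
    unfolding q_def d_def by (rule sieve_g_prime_power[OF p k])
  \<comment> \<open>All fibres of \<open>K q\<close> over \<open>K d\<close> have this size, so
    looking at one of them is enough. The bound says that \<open>q / |K q|\<close> is at least
    \<open>d / |K d|\<close>.\<close>
  have "real (card (K q)) / real (card (K d)) \<le> real p"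
  proof -
    obtain y where "y \<in> K d" using kd by fastforce
    then have "real (card (K q)) / real (card (K d)) = real (card {x\<in>K q. x mod int d = y})"
      using jg by simp
    also have "\<dots> \<le> real p"
      using card_fibre_le[of "K q" p d y] Kfin(3)[OF pos(2)] pos q by auto
    finally show ?thesis .
  qed
  then have "real (card (K q)) * real d \<le> real q * real (card (K d))"
    using kd pos unfolding q by (simp add: field_simps)
  then have g0: "sieve_g K q \<ge> 0" unfolding g using kq kd by (simp add: field_simps)
  then show "sieve_g K (p ^ k) \<ge> 0" by (simp add: q_def)
  have fib: "F d y = (\<Sum>x\<in>{x\<in>K q. x mod int d = y}. F q x)" if "y \<in> K d" for y
  proof -
    have "F d y = (\<Sum>x\<in>{x\<in>K q. x mod int d = y}.
        expsum {n\<in>{n\<in>Z. n mod int d = y}. n mod int q = x} b)"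
      unfolding F_def
      by (rule expsum_fibres) (use Z Kfin pos supp dq in \<open>auto simp: q_def[symmetric] mod_mod_cancel\<close>)
    also have "\<dots> = (\<Sum>x\<in>{x\<in>K q. x mod int d = y}. F q x)"
      unfolding F_def using dq
      by (intro sum.cong refl arg_cong2[where f = expsum]) (auto simp: mod_mod_cancel)
    finally show ?thesis .
  qed
  have "Y \<le> (\<Sum>y\<in>K d. real (card (K q)) / real (card (K d)) *
      (\<Sum>x\<in>{x\<in>K q. x mod int d = y}. (norm (F q x))\<^sup>2))"
    unfolding Y_def
  proof (rule sum_mono)
    fix y assume y: "y \<in> K d"
    show "(norm (F d y))\<^sup>2 \<le> real (card (K q)) / real (card (K d)) *
        (\<Sum>x\<in>{x\<in>K q. x mod int d = y}. (norm (F q x))\<^sup>2)"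
      unfolding fib[OF y] jg[OF y, symmetric] by (rule norm_sum_sq_le_card)
  qed
  also have "\<dots> = real (card (K q)) / real (card (K d)) * X"
    unfolding sum_distrib_left[symmetric] X_def
    by (subst sum.group) (use Kfin pos proj in auto)
  finally have YX: "Y * real (card (K d)) / real (card (K q)) \<le> X"
    using kq kd by (simp add: field_simps)
  have "expsum Z b = (\<Sum>y\<in>K d. F d y)"
    unfolding F_def by (rule expsum_fibres) (use Z Kfin pos suppd in auto)
  then have SY: "(norm (expsum Z b))\<^sup>2 \<le> real (card (K d)) * Y"
    unfolding Y_def by (simp add: norm_sum_sq_le_card)
  \<comment> \<open>After Cauchy-Schwarz over the classes modulo \<open>d\<close>, the weight times
    \<open>|K d| * Y\<close> is \<open>q * Y * |K d| / |K q| - d * Y\<close>, and \<open>YX\<close>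
    bounds this by the difference of the two full sums of squares.\<close>
  have "sieve_g K q * (norm (expsum Z b))\<^sup>2 \<le> sieve_g K q * (real (card (K d)) * Y)"
    by (intro mult_left_mono SY g0)
  also have "\<dots> = real q * (Y * real (card (K d)) / real (card (K q))) - real d * Y"
    unfolding g using kd kq by (simp add: field_simps)
  also have "\<dots> \<le> real q * X - real d * Y"
    using mult_left_mono[OF YX, of "real q"] by simp
  also have "\<dots> = (\<Sum>a\<in>reduced q. (norm (expsum Z (real a / real q + b)))\<^sup>2)"
  proof -
    have "(\<Sum>a<q. (norm (expsum Z (real a / real q + b)))\<^sup>2) = real q * X"
      unfolding X_def by (rule full) (use pos supp in \<open>auto simp: q_def\<close>)
    moreover have "(\<Sum>a<d. (norm (expsum Z (real a / real d + b)))\<^sup>2) = real d * Y"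
      unfolding Y_def by (rule full) (use pos suppd in auto)
    ultimately show ?thesis
      using sum_reduced_prime_power[OF p k, of "\<lambda>x. (norm (expsum Z (x + b)))\<^sup>2"]
      unfolding q_def[symmetric] d_def[symmetric] by simp
  qed
  finally show "sieve_g K (p ^ k) * (norm (expsum Z b))\<^sup>2
       \<le> (\<Sum>a\<in>reduced (p ^ k). (norm (expsum Z (real a / real (p ^ k) + b)))\<^sup>2)"
    by (simp add: q_def)
qed

lemma sieve_g_mult_prime_power:
  assumes "prime p" "k \<ge> 1" "m > 0" "\<not> p dvd m"
  shows "sieve_g K (p ^ k * m) = sieve_g K (p ^ k) * sieve_g K m"
proof -
  have p0: "p ^ k > 0" "p ^ k \<noteq> 0" using assms(1) prime_gt_0_nat by auto
  have pf: "prime_factors (p ^ k * m) = insert p (prime_factors m)" "p \<notin> prime_factors m"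
    "prime_factors (p ^ k) = {p}"
    using assms p0 by (auto simp: prime_factorization_mult prime_factorization_prime_power)
  have mp: "multiplicity p (p ^ k * m) = multiplicity p (p ^ k)"
    using assms p0 by (simp add: prime_elem_multiplicity_mult_distrib not_dvd_imp_multiplicity_0)
  have mr: "multiplicity r (p ^ k * m) = multiplicity r m" if "r \<in> prime_factors m" for r
  proof -
    have "prime r" "r \<noteq> p" using that pf(2) by auto
    then show ?thesis
      using assms p0 by (simp add: prime_elem_multiplicity_mult_distrib multiplicity_distinct_prime_power)
  qed
  show ?thesis
    unfolding sieve_g_def pf using pf(2) mp mr by (simp cong: prod.cong)
qed

lemma sieve_g_nonneg:
  assumes "residue_sets K" "consistent_sets K" "johnsen_gallagher K"
  shows "sieve_g K q \<ge> 0"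
  unfolding sieve_g_def Let_def
proof (rule prod_nonneg)
  fix r assume r: "r \<in> prime_factors q"
  let ?j = "multiplicity r q"
  have r: "prime r" "?j \<ge> 1" using r by (auto simp: prime_factors_multiplicity)
  then have "sieve_g K (r ^ ?j) \<ge> 0"
    using sieve_g_prime_power_bound(1)[OF assms r, of "{}"] by auto
  then show "real (r ^ ?j) / real (card (K (r ^ ?j)))
      - real (r ^ (?j - 1)) / real (card (K (r ^ (?j - 1)))) \<ge> 0"
    by (simp only: sieve_g_prime_power[OF r])
qed

text \<open>The Chinese Remainder Theorem for fractions: modulo 1, \<open>a / m + c / n\<close> has
  numerator \<open>a * n + c * m\<close> over \<open>m * n\<close>. Coprimality makes this an
  injection into the reduced residues, which suffices since \<open>f\<close> is nonnegative and has
  period 1.\<close>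

lemma reduced_product_le:
  fixes f :: "real \<Rightarrow> real"
  assumes "coprime m n" "m > 0" "n > 0"
    and "\<And>x. f x \<ge> 0" "\<And>x (k::int). f (x + of_int k) = f x"
  shows "(\<Sum>a\<in>reduced m. \<Sum>c\<in>reduced n. f (real a / real m + real c / real n))
       \<le> (\<Sum>a\<in>reduced (m * n). f (real a / real (m * n)))"
proof -
  have co: "coprime n m" using assms(1) by (rule coprime_imp_coprime) auto
  define h where "h = (\<lambda>(a, c). (a * n + c * m) mod (m * n))"
  have inj: "inj_on h (reduced m \<times> reduced n)"
  proof (rule inj_onI, clarify)
    fix a c a' c'
    assume *: "a \<in> reduced m" "c \<in> reduced n" "a' \<in> reduced m" "c' \<in> reduced n"
      and "h (a, c) = h (a', c')"
    then have eq: "[a * n + c * m = a' * n + c' * m] (mod m * n)" by (simp add: h_def cong_def)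
    have "[a * n = a' * n] (mod m)"
      using cong_modulus_mult_nat[OF eq] by (simp add: cong_def)
    then have "[a = a'] (mod m)" using co cong_mult_rcancel_nat by blast
    moreover have "[c * m = c' * m] (mod n)"
    proof -
      have "[a * n + c * m = a' * n + c' * m] (mod n * m)" using eq by (simp only: mult.commute)
      from cong_modulus_mult_nat[OF this] show ?thesis by (simp add: cong_def)
    qed
    then have "[c = c'] (mod n)" using assms(1) cong_mult_rcancel_nat by blast
    ultimately show "a = a' \<and> c = c'"
      using * unfolding reduced_def by (auto intro: cong_less_modulus_unique_nat)
  qed
  have ran: "h ` (reduced m \<times> reduced n) \<subseteq> reduced (m * n)"
  proof clarify
    fix a c assume "a \<in> reduced m" "c \<in> reduced n"
    then have "coprime (a * n) m" "coprime (c * m) n"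
      using assms(1) co by (auto simp: reduced_def)
    then have "coprime (a * n + c * m) m" "coprime (a * n + c * m) n"
      by (simp_all only: coprime_iff_gcd_eq_1 gcd.commute[of _ m] gcd.commute[of _ n])
        (metis add.commute gcd_add_mult mult.commute)+
    then have "coprime (a * n + c * m) (m * n)" by simp
    moreover have "m * n \<noteq> 0" using assms by simp
    ultimately have "coprime (h (a, c)) (m * n)"
      unfolding h_def prod.case using coprime_mod_left_iff by blast
    moreover have "h (a, c) < m * n" using assms by (simp add: h_def)
    ultimately show "h (a, c) \<in> reduced (m * n)" unfolding reduced_def by blast
  qed
  have val: "f (real a / real m + real c / real n) = f (real (h (a, c)) / real (m * n))" for a c
  proof -
    let ?x = "a * n + c * m"
    have "real a / real m + real c / real n = real ?x / real (m * n)"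
      using assms by (simp add: field_simps)
    also have "real ?x = real (?x mod (m * n)) + real (m * n) * real (?x div (m * n))"
      by (metis mod_mult_div_eq of_nat_add of_nat_mult)
    also have "\<dots> / real (m * n) = real (?x mod (m * n)) / real (m * n) + real (?x div (m * n))"
      using assms by (simp add: add_divide_distrib)
    also have "\<dots> = real (h (a, c)) / real (m * n) + of_int (int (?x div (m * n)))"
      by (simp add: h_def)
    finally show ?thesis by (simp only: assms(5))
  qed
  have "(\<Sum>a\<in>reduced m. \<Sum>c\<in>reduced n. f (real a / real m + real c / real n))
      = (\<Sum>z\<in>reduced m \<times> reduced n. f (real (h z) / real (m * n)))"
    unfolding sum.cartesian_product by (rule sum.cong) (auto simp: val)
  also have "\<dots> = (\<Sum>a\<in>h ` (reduced m \<times> reduced n). f (real a / real (m * n)))"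
    by (simp add: sum.reindex[OF inj])
  also have "\<dots> \<le> (\<Sum>a\<in>reduced (m * n). f (real a / real (m * n)))"
    by (rule sum_mono2) (use ran assms(4) in auto)
  finally show ?thesis .
qed

text \<open>
  The inequality is proved for all shifts \<open>b\<close> at once: this is what allows the prime
  powers dividing \<open>q\<close> to be split off one after the other.
\<close>

lemma sieve_g_bound:
  assumes K: "residue_sets K" "consistent_sets K" "johnsen_gallagher K" and Z: "finite Z"
  shows "q > 0 \<Longrightarrow> (\<And>n d. n \<in> Z \<Longrightarrow> d dvd q \<Longrightarrow> n mod int d \<in> K d) \<Longrightarrow>
     sieve_g K q * (norm (expsum Z b))\<^sup>2
       \<le> (\<Sum>a\<in>reduced q. (norm (expsum Z (real a / real q + b)))\<^sup>2)"
proof (induction q arbitrary: b rule: less_induct)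
  case (less q)
  show ?case
  proof (cases "q = 1")
    case True
    then have "reduced q = {0}" by (auto simp: reduced_def)
    then show ?thesis using True by (simp add: sieve_g_def)
  next
    case False
    then obtain p where p: "prime p" "p dvd q" using prime_factor_nat by blast
    define k where "k = multiplicity p q"
    have k: "k \<ge> 1"
      using p less.prems(1) unfolding k_def
      by (metis Suc_eq_plus1 le_add2 multiplicity_gt_zero_iff not_less_eq_eq not_prime_unit
          One_nat_def Suc_leI neq0_conv)
    obtain m where m: "q = p ^ k * m" "\<not> p dvd m"
      using multiplicity_decompose'[of q p] p less.prems(1) unfolding k_def
      by (metis not_prime_unit neq0_conv)
    have pk1: "p ^ k > 1" using p k by (metis One_nat_def Suc_le_lessD one_less_power prime_gt_1_nat)
    have m0: "m > 0" using m less.prems(1) by (cases m) auto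
    have mq: "m < q" using m m0 pk1 by simp
    have co: "coprime (p ^ k) m" using p m by (simp add: prime_imp_coprime_nat)
    let ?f = "\<lambda>x. (norm (expsum Z (x + b)))\<^sup>2"
    have per: "?f (x + of_int i) = ?f x" for x i
      using expsum_add_int[of Z "x + b" i] by (simp add: algebra_simps)
    have supp: "n mod int (p ^ k) \<in> K (p ^ k)" if "n \<in> Z" for n
      using less.prems(2)[OF that] m(1) by (metis dvd_triv_left)
    have pp: "sieve_g K (p ^ k) * (norm (expsum Z b))\<^sup>2
          \<le> (\<Sum>a\<in>reduced (p ^ k). (norm (expsum Z (real a / real (p ^ k) + b)))\<^sup>2)" for b
      by (rule sieve_g_prime_power_bound(2)[OF K p(1) k Z supp])
    have gm: "sieve_g K m \<ge> 0" by (rule sieve_g_nonneg[OF K])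
    have "sieve_g K q * ?f 0 = sieve_g K m * (sieve_g K (p ^ k) * (norm (expsum Z b))\<^sup>2)"
      using sieve_g_mult_prime_power[OF p(1) k m0 m(2), of K] m by (simp add: mult_ac)
    also have "\<dots> \<le> sieve_g K m * (\<Sum>a\<in>reduced (p ^ k). (norm (expsum Z (real a / real (p ^ k) + b)))\<^sup>2)"
      by (intro mult_left_mono pp gm)
    also have "\<dots> = (\<Sum>a\<in>reduced (p ^ k). sieve_g K m * (norm (expsum Z (real a / real (p ^ k) + b)))\<^sup>2)"
      by (rule sum_distrib_left)
    also have "\<dots> \<le> (\<Sum>a\<in>reduced (p ^ k). \<Sum>c\<in>reduced m.
        (norm (expsum Z (real c / real m + (real a / real (p ^ k) + b))))\<^sup>2)"
      by (intro sum_mono less.IH mq m0) (use less.prems m in auto)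
    also have "\<dots> = (\<Sum>a\<in>reduced (p ^ k). \<Sum>c\<in>reduced m. ?f (real a / real (p ^ k) + real c / real m))"
      by (simp add: algebra_simps)
    also have "\<dots> \<le> (\<Sum>a\<in>reduced (p ^ k * m). ?f (real a / real (p ^ k * m)))"
      by (rule reduced_product_le[OF co _ m0 _ per]) (use pk1 in \<open>linarith, simp\<close>)
    finally show ?thesis using m by simp
  qed
qed

subsection \<open>Disjoint arcs around reduced fractions\<close>

definition arc_energy :: "int set \<Rightarrow> real \<Rightarrow> real" where
  "arc_energy Z r = integral {-r..r} (\<lambda>x. (norm (expsum Z x))\<^sup>2)"

lemma continuous_on_expsum [continuous_intros]:
  "continuous_on A f \<Longrightarrow> continuous_on A (\<lambda>x. expsum Z (f x))"
  unfolding expsum_def cis_conv_exp by (intro continuous_intros)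

lemma norm_expsum_sq_cos:
  "(norm (expsum Z x))\<^sup>2 = (\<Sum>n\<in>Z. \<Sum>m\<in>Z. cos (2 * pi * of_int (n - m) * x))"
  using arg_cong[OF norm_expsum_sq[of Z x], of Re] by (simp only: Re_complex_of_real Re_sum cis.sel)

lemma has_integral_cos_unit:
  "((\<lambda>x. cos (2 * pi * of_int k * x)) has_integral (if k = 0 then 1 else 0)) {c..c + (1::real)}"
proof (cases "k = 0")
  case True
  then show ?thesis using has_integral_const_real[of "1::real" c "c + 1"] by simp
next
  case False
  let ?F = "\<lambda>x. sin (2 * pi * of_int k * x) / (2 * pi * of_int k)"
  have "((\<lambda>x. cos (2 * pi * of_int k * x)) has_integral (?F (c + 1) - ?F c)) {c..c + 1}"
  proof (rule fundamental_theorem_of_calculus)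
    fix x :: real
    show "(?F has_vector_derivative cos (2 * pi * of_int k * x)) (at x within {c..c + 1})"
      using False unfolding has_real_derivative_iff_has_vector_derivative[symmetric]
      by (auto intro!: derivative_eq_intros)
  qed simp
  moreover have "sin (2 * pi * of_int k * (c + 1)) = sin (2 * pi * of_int k * c)"
    using sin_int_2pin[of k] cos_int_2pin[of k] by (simp add: distrib_left sin_add mult_ac)
  ultimately show ?thesis using False by simp
qed

lemma has_integral_norm_expsum_sq_unit:
  assumes "finite Z"
  shows "((\<lambda>x. (norm (expsum Z x))\<^sup>2) has_integral real (card Z)) {c..c + 1}"
proof -
  have "((\<lambda>x. \<Sum>n\<in>Z. \<Sum>m\<in>Z. cos (2 * pi * of_int (n - m) * x))
      has_integral (\<Sum>n\<in>Z. \<Sum>m\<in>Z. if n - m = 0 then 1 else 0)) {c..c + 1}"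
    by (intro has_integral_sum has_integral_cos_unit assms)
  moreover have "(\<Sum>n\<in>Z. \<Sum>m\<in>Z. if n - m = 0 then 1 else (0::real)) = real (card Z)"
    using assms by (simp add: sum.delta)
  ultimately show ?thesis by (simp add: norm_expsum_sq_cos)
qed

text \<open>Neighbouring intervals may share an end point, so overlaps are negligible but not empty.
  The union is taken over a set of intervals, so distinct indices must give distinct intervals;
  positive lengths ensure this.\<close>

lemma sum_integral_nonoverlapping_le:
  fixes f :: "real \<Rightarrow> real"
  assumes "finite I" "continuous_on {A..B} f" "\<And>x. f x \<ge> 0"
    and "\<And>i. i \<in> I \<Longrightarrow> A \<le> l i \<and> l i < u i \<and> u i \<le> B"
    and "\<And>i j. i \<in> I \<Longrightarrow> j \<in> I \<Longrightarrow> i \<noteq> j \<Longrightarrow> u i \<le> l j \<or> u j \<le> l i"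
  shows "(\<Sum>i\<in>I. integral {l i..u i} f) \<le> integral {A..B} f"
proof -
  define J where "J i = {l i..u i}" for i
  have inj: "inj_on J I"
  proof (rule inj_onI, rule ccontr)
    fix i j assume *: "i \<in> I" "j \<in> I" "J i = J j" "i \<noteq> j"
    then have "l i = l j" "u i = u j"
      using assms(4)[OF *(1)] unfolding J_def by auto
    then show False using assms(4)[OF *(1)] assms(5)[OF *(1,2,4)] by auto
  qed
  have int: "f integrable_on {a..b}" if "A \<le> a" "b \<le> B" for a b
    by (rule integrable_continuous_real, rule continuous_on_subset[OF assms(2)]) (use that in auto)
  have "(f has_integral (\<Sum>S\<in>J ` I. integral S f)) (\<Union> (J ` I))"
  proof (rule has_integral_Union)
    show "pairwise (\<lambda>S S'. negligible (S \<inter> S')) (J ` I)"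
    proof (rule pairwiseI, clarify)
      fix i j assume *: "i \<in> I" "j \<in> I" "J i \<noteq> J j"
      then have "i \<noteq> j" by auto
      from assms(5)[OF *(1,2) this] have "J i \<inter> J j \<subseteq> {l i, u i}" unfolding J_def by auto
      then show "negligible (J i \<inter> J j)"
        by (rule negligible_subset[rotated]) (rule negligible_finite, simp)
    qed
  qed (use assms int in \<open>auto simp: J_def intro!: integrable_integral\<close>)
  then have "(f has_integral (\<Sum>i\<in>I. integral (J i) f)) (\<Union> (J ` I))"
    by (simp add: sum.reindex[OF inj])
  then have "(\<Sum>i\<in>I. integral (J i) f) \<le> integral {A..B} f"
    by (rule has_integral_subset_le[rotated])
      (use assms int in \<open>force simp: J_def intro!: integrable_integral\<close>)+
  then show ?thesis by (simp add: J_def)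
qed

text \<open>The difference is an integer over \<open>q * s\<close>. Were that integer zero,
  coprimality would make \<open>q\<close> and \<open>s\<close> divide each other and the two
  fractions would coincide.\<close>

lemma reduced_fraction_distance:
  assumes "a \<in> reduced q" "b \<in> reduced s" "(q, a) \<noteq> (s, b)" "q > 0" "s > 0"
  shows "1 / (real q * real s) \<le> \<bar>real a / real q - real b / real s\<bar>"
proof -
  have "a * s \<noteq> b * q"
  proof
    assume eq: "a * s = b * q"
    have "q dvd s"
      using assms(1) eq by (metis coprime_commute coprime_dvd_mult_right_iff dvd_triv_right mem_Collect_eq reduced_def)
    moreover have "s dvd q"
      using assms(2) eq by (metis coprime_commute coprime_dvd_mult_right_iff dvd_triv_right mem_Collect_eq reduced_def)
    ultimately have "q = s" by (rule dvd_antisym)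
    then show False using eq assms by simp
  qed
  then have "1 \<le> \<bar>int (a * s) - int (b * q)\<bar>" by linarith
  then have "1 \<le> \<bar>real (a * s) - real (b * q)\<bar>"
    by (metis of_int_1_le_iff of_int_abs of_int_diff of_int_of_nat_eq)
  moreover have "real a / real q - real b / real s = (real (a * s) - real (b * q)) / (real q * real s)"
    using assms by (simp add: field_simps)
  ultimately show ?thesis using assms by (simp add: divide_right_mono)
qed

text \<open>The radii for \<open>q\<close> and \<open>s\<close> add up to
  \<open>(q + s) / (2 * Q)\<close> times \<open>1 / (q * s)\<close>, and the first factor is at most
  1. So the arcs do not overlap, and Parseval over one period bounds the total.\<close>

lemma sum_arcs_le:
  assumes Z: "finite Z" and Q: "Q \<ge> 1"
  shows "(\<Sum>q | 1 \<le> q \<and> real q \<le> Q. \<Sum>a\<in>reduced q.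
      integral {-(1 / (2 * real q * Q))..1 / (2 * real q * Q)} (\<lambda>b. (norm (expsum Z (real a / real q + b)))\<^sup>2))
    \<le> real (card Z)"
proof -
  define D where "D q = 1 / (2 * real q * Q)" for q
  define f where "f x = (norm (expsum Z x))\<^sup>2" for x
  define I where "I = (SIGMA q:{q. 1 \<le> q \<and> real q \<le> Q}. reduced q)"
  have "{q. 1 \<le> q \<and> real q \<le> Q} \<subseteq> {..nat \<lfloor>Q\<rfloor>}" by (auto simp: le_nat_floor)
  then have finq: "finite {q. 1 \<le> q \<and> real q \<le> Q}" by (rule finite_subset) simp
  then have fin: "finite I" unfolding I_def by (intro finite_SigmaI) auto
  have contf: "continuous_on A f" for A unfolding f_def by (intro continuous_intros)
  have shift: "integral {-D q..D q} (\<lambda>b. f (real a / real q + b))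
      = integral {real a / real q - D q..real a / real q + D q} f" for a q
    using integral_shift[OF contf, of "-D q" "D q" "real a / real q"]
    by (simp add: o_def add.commute)
  have "(\<Sum>q | 1 \<le> q \<and> real q \<le> Q. \<Sum>a\<in>reduced q. integral {-D q..D q} (\<lambda>b. f (real a / real q + b)))
      = (\<Sum>(q, a)\<in>I. integral {real a / real q - D q..real a / real q + D q} f)"
    unfolding I_def shift by (rule sum.Sigma) (use finq in auto)
  also have "\<dots> = (\<Sum>i\<in>I. integral {real (snd i) / real (fst i) - D (fst i)..real (snd i) / real (fst i) + D (fst i)} f)"
    by (rule sum.cong) auto
  \<comment> \<open>The period starts at the left end of the arc around 0 for \<open>q = 1\<close>.
    With this choice no arc wraps around: \<open>a / q\<close> is at most \<open>1 - 1 / q\<close>,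
    which leaves room for the radius on the right.\<close>
  also have "\<dots> \<le> integral {- 1 / (2 * Q).. - 1 / (2 * Q) + 1} f"
  proof (rule sum_integral_nonoverlapping_le[OF fin contf])
    fix i assume "i \<in> I"
    then obtain q a where i: "i = (q, a)" "1 \<le> q" "real q \<le> Q" "a \<in> reduced q"
      unfolding I_def by auto
    have Dq: "D q > 0" "D q \<le> 1 / (2 * Q)" using i Q unfolding D_def by (auto simp: field_simps)
    have "real a + 1 \<le> real q" using i(4) by (auto simp: reduced_def)
    then have "real a / real q \<le> 1 - 1 / real q" using i(2) by (simp add: field_simps)
    moreover have "1 / (2 * Q) + D q \<le> 1 / real q"
    proof -
      have "1 / (2 * Q) \<le> 1 / (2 * real q)" using i Q by (simp add: field_simps)
      moreover have "D q \<le> 1 / (2 * real q)" using i Q unfolding D_def by (simp add: field_simps)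
      ultimately show ?thesis by simp
    qed
    moreover have "0 \<le> real a / real q" by simp
    ultimately show "- 1 / (2 * Q) \<le> real (snd i) / real (fst i) - D (fst i) \<and>
        real (snd i) / real (fst i) - D (fst i) < real (snd i) / real (fst i) + D (fst i) \<and>
        real (snd i) / real (fst i) + D (fst i) \<le> - 1 / (2 * Q) + 1"
      using Dq unfolding i fst_conv snd_conv minus_divide_left[symmetric] by (intro conjI; linarith)
  next
    fix i j assume *: "i \<in> I" "j \<in> I" "i \<noteq> j"
    from * obtain q a s b where i: "i = (q, a)" "1 \<le> q" "real q \<le> Q" "a \<in> reduced q"
      and j: "j = (s, b)" "1 \<le> s" "real s \<le> Q" "b \<in> reduced s"
      unfolding I_def by auto
    have "D q + D s = (real q + real s) / (2 * Q) * (1 / (real q * real s))"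
      using i j Q unfolding D_def by (simp add: field_simps)
    also have "\<dots> \<le> 1 * (1 / (real q * real s))"
      using i j Q by (intro mult_right_mono) (auto simp: field_simps)
    also have "\<dots> \<le> \<bar>real a / real q - real b / real s\<bar>"
      using reduced_fraction_distance[OF i(4) j(4)] i j * by auto
    finally show "real (snd i) / real (fst i) + D (fst i) \<le> real (snd j) / real (fst j) - D (fst j) \<or>
        real (snd j) / real (fst j) + D (fst j) \<le> real (snd i) / real (fst i) - D (fst i)"
      unfolding i j by auto
  qed (simp add: f_def)
  also have "\<dots> = real (card Z)"
    unfolding f_def using has_integral_norm_expsum_sq_unit[OF Z] by (rule integral_unique)
  finally show ?thesis unfolding D_def f_def .
qed

text \<open>The local inequality holds at every shift \<open>b\<close>, so it can be integrated over
  the arc around 0; the shifted terms become the arcs around the reduced fractions. Support up to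
  \<open>Q\<close> covers all divisors of each modulus in the sum.\<close>

lemma sum_sieve_g_arc_energy_le:
  assumes K: "residue_sets K" "consistent_sets K" "johnsen_gallagher K"
    and Z: "finite Z" and Q: "Q \<ge> 1" and supp: "has_support K Q Z"
  shows "(\<Sum>q | 1 \<le> q \<and> real q \<le> Q. sieve_g K q * arc_energy Z (1 / (2 * real q * Q))) \<le> real (card Z)"
proof -
  have main: "sieve_g K q * arc_energy Z r
     \<le> (\<Sum>a\<in>reduced q. integral {-r..r} (\<lambda>b. (norm (expsum Z (real a / real q + b)))\<^sup>2))"
    if q: "1 \<le> q" "real q \<le> Q" for q r
  proof -
    have int: "(\<lambda>b. (norm (expsum Z (c + b)))\<^sup>2) integrable_on {-r..r}" for c
      by (intro integrable_continuous_real continuous_intros)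
    have "n mod int d \<in> K d" if "n \<in> Z" "d dvd q" for n d
    proof -
      have "1 \<le> d" "d \<le> q" using that q by (auto simp: Suc_le_eq intro: dvd_pos_nat dvd_imp_le)
      then show ?thesis using supp that(1) q unfolding has_support_def by force
    qed
    then have "sieve_g K q * (norm (expsum Z b))\<^sup>2
       \<le> (\<Sum>a\<in>reduced q. (norm (expsum Z (real a / real q + b)))\<^sup>2)" for b
      using sieve_g_bound[OF K Z] q by simp
    then have "integral {-r..r} (\<lambda>b. sieve_g K q * (norm (expsum Z b))\<^sup>2)
       \<le> integral {-r..r} (\<lambda>b. \<Sum>a\<in>reduced q. (norm (expsum Z (real a / real q + b)))\<^sup>2)"
      by (intro integral_le integrable_continuous_real continuous_intros) auto
    also have "\<dots> = (\<Sum>a\<in>reduced q. integral {-r..r} (\<lambda>b. (norm (expsum Z (real a / real q + b)))\<^sup>2))"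
      by (rule integral_sum) (use int in auto)
    finally show ?thesis unfolding arc_energy_def by simp
  qed
  have "(\<Sum>q | 1 \<le> q \<and> real q \<le> Q. sieve_g K q * arc_energy Z (1 / (2 * real q * Q)))
    \<le> (\<Sum>q | 1 \<le> q \<and> real q \<le> Q. \<Sum>a\<in>reduced q.
      integral {-(1 / (2 * real q * Q))..1 / (2 * real q * Q)} (\<lambda>b. (norm (expsum Z (real a / real q + b)))\<^sup>2))"
    by (rule sum_mono, rule main) simp_all
  also note sum_arcs_le[OF Z Q]
  finally show ?thesis .
qed

subsection \<open>Comparison with an interval\<close>

lemma integral_antimono_mult_le:
  fixes f h :: "real \<Rightarrow> real"
  assumes "a \<le> b" and h: "h integrable_on {a..b}"
    and mono: "\<And>x y. a \<le> x \<Longrightarrow> x \<le> y \<Longrightarrow> y \<le> b \<Longrightarrow> f y \<le> f x"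
    and pos: "f b \<ge> 0" and B: "\<And>c. a \<le> c \<Longrightarrow> c \<le> b \<Longrightarrow> \<bar>integral {a..c} h\<bar> \<le> B"
  shows "\<bar>integral {a..b} (\<lambda>x. f x * h x)\<bar> \<le> f a * B"
proof -
  \<comment> \<open>The second mean value theorem is available for increasing weights, hence the
    minus sign. Regrouping with the nonnegative weights \<open>f a - f b\<close> and
    \<open>f b\<close> leaves only integrals of \<open>h\<close> over initial segments.\<close>
  obtain c where c: "c \<in> {a..b}" "integral {a..b} (\<lambda>x. - f x * h x)
      = - f a * integral {a..c} h + - f b * integral {c..b} h"
    by (rule second_mean_value_theorem[OF h assms(1), of "\<lambda>x. - f x"]) (use mono in auto)
  have "integral {a..c} h + integral {c..b} h = integral {a..b} h"
    by (rule Henstock_Kurzweil_Integration.integral_combine) (use c h in auto)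
  then have "integral {a..b} (\<lambda>x. f x * h x)
      = (f a - f b) * integral {a..c} h + f b * integral {a..b} h"
    unfolding \<open>integral {a..c} h + integral {c..b} h = integral {a..b} h\<close>[symmetric]
    using c(2) by (simp add: algebra_simps)
  also have "\<bar>\<dots>\<bar> \<le> \<bar>(f a - f b) * integral {a..c} h\<bar> + \<bar>f b * integral {a..b} h\<bar>"
    by (rule abs_triangle_ineq)
  also have "\<dots> \<le> (f a - f b) * B + f b * B"
    unfolding abs_mult using mono[of a b] pos B[of c] B[of b] c assms(1)
    by (intro add_mono mult_mono) auto
  finally show ?thesis by (simp add: algebra_simps)
qed

lemma abs_integral_sin_le:
  assumes "l > 0" "a \<le> c"
  shows "\<bar>integral {a..c} (\<lambda>x. sin (l * x))\<bar> \<le> 2 / (l::real)"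
proof -
  have "((\<lambda>x. sin (l * x)) has_integral (- cos (l * c) / l - - cos (l * a) / l)) {a..c}"
    using assms(1) by (intro fundamental_theorem_of_calculus assms(2))
      (auto intro!: derivative_eq_intros simp: has_real_derivative_iff_has_vector_derivative[symmetric])
  then have "integral {a..c} (\<lambda>x. sin (l * x)) = (cos (l * a) - cos (l * c)) / l"
    using assms(1) by (simp add: integral_unique field_simps)
  moreover have "\<bar>cos (l * a) - cos (l * c)\<bar> \<le> 2"
    using abs_cos_le_one[of "l * a"] abs_cos_le_one[of "l * c"] by linarith
  ultimately show ?thesis using assms(1) by (simp add: divide_right_mono)
qed

lemma abs_integral_cos_le:
  assumes "l > 0" "a \<le> c"
  shows "\<bar>integral {a..c} (\<lambda>x. cos (l * x))\<bar> \<le> 2 / (l::real)"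
proof -
  have "((\<lambda>x. cos (l * x)) has_integral (sin (l * c) / l - sin (l * a) / l)) {a..c}"
    using assms(1) by (intro fundamental_theorem_of_calculus assms(2))
      (auto intro!: derivative_eq_intros simp: has_real_derivative_iff_has_vector_derivative[symmetric])
  then have "integral {a..c} (\<lambda>x. cos (l * x)) = (sin (l * c) - sin (l * a)) / l"
    using assms(1) by (simp add: integral_unique field_simps)
  moreover have "\<bar>sin (l * c) - sin (l * a)\<bar> \<le> 2"
    using abs_sin_le_one[of "l * a"] abs_sin_le_one[of "l * c"] by linarith
  ultimately show ?thesis using assms(1) by (simp add: divide_right_mono)
qed

lemma sin_ge_cubic:
  assumes "x \<ge> 0"
  shows "sin x \<ge> x - x ^ 3 / (6::real)"
proof (cases "x = 0")
  case False
  then obtain t where t: "sin x = (\<Sum>m<3. sin_coeff m * x ^ m) + sin (t + 1 / 2 * real 3 * pi) / fact 3 * x ^ 3"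
    using Maclaurin_sin_expansion3[of 3 x] assms by auto
  define s where "s = sin (t + 1 / 2 * real 3 * pi)"
  have sum3: "(\<Sum>m<3. sin_coeff m * x ^ m) = x"
    by (simp add: lessThan_Suc numeral_3_eq_3 sin_coeff_def)
  have fact3: "fact 3 = (6::real)" by (simp add: fact_numeral)
  have eq: "sin x = x + s / 6 * x ^ 3"
    using t unfolding s_def[symmetric] sum3 fact3 .
  have "(-1) * x ^ 3 \<le> s * x ^ 3"
    unfolding s_def using assms by (intro mult_right_mono sin_ge_minus_one zero_le_power)
  then show ?thesis unfolding eq by simp
qed simp

lemma sin_pi_mono:
  assumes "0 \<le> x" "x \<le> y" "y \<le> 1 / 2"
  shows "sin (pi * x) \<le> sin (pi * y)"
proof (rule sin_monotone_2pi_le)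
  have "0 \<le> pi * x" using assms by simp
  then show "- (pi / 2) \<le> pi * x" using pi_gt_zero by linarith
  show "pi * x \<le> pi * y" using assms by simp
  show "pi * y \<le> pi / 2" using mult_left_mono[OF assms(3), of pi] by simp
qed

text \<open>Deliberately crude, with slope 1 in place of the sharp 2: since \<open>pi * x\<close> is
  at most 2, the cubic bound keeps one third of \<open>pi * x\<close>, which is at least
  \<open>x\<close>.\<close>

lemma sin_pi_ge:
  assumes "0 \<le> x" "x \<le> 1 / 2"
  shows "sin (pi * x) \<ge> x"
proof -
  have "(pi * x)\<^sup>2 \<le> 2\<^sup>2"
  proof (rule power_mono)
    have "pi * x \<le> 4 * (1 / 2)" using assms pi_less_4 by (intro mult_mono) auto
    then show "pi * x \<le> 2" by simp
  qed (use assms in auto)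
  then have "(pi * x) * (pi * x)\<^sup>2 \<le> (pi * x) * 4"
    using assms by (intro mult_left_mono) auto
  moreover have "(pi * x) ^ 3 = (pi * x) * (pi * x)\<^sup>2" by (simp add: eval_nat_numeral)
  ultimately have "(pi * x) ^ 3 / 6 \<le> 2 / 3 * (pi * x)" by linarith
  moreover have "pi * x \<ge> 3 * x" using assms pi_gt3 by (intro mult_right_mono) auto
  ultimately show ?thesis using sin_ge_cubic[of "pi * x"] assms by simp
qed

section \<open>The Dirichlet kernel and its mass on an arc\<close>

definition dirichlet_kernel :: "nat \<Rightarrow> real \<Rightarrow> real" where
  "dirichlet_kernel h x = 1 + 2 * (\<Sum>j=1..h. cos (2 * pi * real j * x))"

text \<open>Each new cosine times \<open>2 * sin (pi * x)\<close> telescopes by the addition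
  formulas. In product form the closed expression is valid also at the zeros of
  \<open>sin (pi * x)\<close>.\<close>

lemma dirichlet_kernel_sin:
  "dirichlet_kernel h x * sin (pi * x) = sin ((2 * real h + 1) * pi * x)"
proof (induction h)
  case 0
  then show ?case by (simp add: dirichlet_kernel_def)
next
  case (Suc h)
  let ?c = "2 * pi * real (Suc h) * x"
  have "dirichlet_kernel (Suc h) x * sin (pi * x)
      = sin ((2 * real h + 1) * pi * x) + 2 * cos ?c * sin (pi * x)"
    using Suc by (simp add: dirichlet_kernel_def algebra_simps)
  moreover have "(2 * real h + 1) * pi * x = ?c - pi * x"
    "(2 * real (Suc h) + 1) * pi * x = ?c + pi * x" by (simp_all add: algebra_simps)
  ultimately show ?case by (simp only: sin_diff sin_add)
qed

lemma continuous_on_dirichlet_kernel: "continuous_on A (dirichlet_kernel h)"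
  unfolding dirichlet_kernel_def by (intro continuous_intros)

lemma integral_dirichlet_kernel_unit: "integral {-1/2..1/2} (dirichlet_kernel h) = 1"
proof -
  have "(dirichlet_kernel h has_integral (1 + 2 * (\<Sum>j=1..h. 0))) {-1/2..1/2}"
  proof -
    have "((\<lambda>x. cos (2 * pi * real j * x)) has_integral 0) {-1/2..1/2}" if "j \<in> {1..h}" for j
      using has_integral_cos_unit[of "int j" "-1/2"] that by auto
    then have "((\<lambda>x. 2 * (\<Sum>j=1..h. cos (2 * pi * real j * x))) has_integral 2 * (\<Sum>j=1..h. 0)) {-1/2..1/2}"
      by (intro has_integral_mult_right has_integral_sum) auto
    moreover have "((\<lambda>x::real. 1::real) has_integral 1) {-1/2..1/2}"
      using has_integral_const_real[of "1::real" "-1/2" "1/2"] by simp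
    ultimately show ?thesis unfolding dirichlet_kernel_def by (intro has_integral_add)
  qed
  then show ?thesis by (simp add: integral_unique)
qed

text \<open>The kernel has mass 1 over a period. Off the arc it is a rapidly oscillating sine times
  the decreasing weight \<open>1 / sin (pi * x)\<close>, so each of the two tails is at most
  \<open>1 / (2 * h * r)\<close>.\<close>

lemma integral_dirichlet_kernel_ge:
  assumes "0 < r" "r \<le> 1 / 2" "h \<ge> 1"
  shows "integral {-r..r} (dirichlet_kernel h) \<ge> 1 - 1 / (real h * r)"
proof -
  let ?D = "dirichlet_kernel h" and ?l = "(2 * real h + 1) * pi"
  have int: "?D integrable_on {a..b}" for a b
    by (intro integrable_continuous_real continuous_on_dirichlet_kernel)
  have even: "?D (- x) = ?D x" for x by (simp add: dirichlet_kernel_def)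
  have "integral {r..1/2} ?D = integral {r..1/2} (\<lambda>x. 1 / sin (pi * x) * sin (?l * x))"
  proof (rule integral_cong)
    fix x assume "x \<in> {r..1/2}"
    then have "sin (pi * x) > 0" using sin_pi_ge[of x] assms by auto
    then show "?D x = 1 / sin (pi * x) * sin (?l * x)"
      using dirichlet_kernel_sin[of h x] by (simp add: field_simps)
  qed
  also have "\<bar>\<dots>\<bar> \<le> 1 / sin (pi * r) * (2 / ?l)"
  proof (rule integral_antimono_mult_le)
    show "(\<lambda>x. sin (?l * x)) integrable_on {r..1/2}"
      by (intro integrable_continuous_real continuous_intros)
    show "1 / sin (pi * y) \<le> 1 / sin (pi * x)" if "r \<le> x" "x \<le> y" "y \<le> 1 / 2" for x y
      using sin_pi_mono[of x y] sin_pi_ge[of x] that assms by (intro divide_left_mono) auto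
    show "\<bar>integral {r..c} (\<lambda>x. sin (?l * x))\<bar> \<le> 2 / ?l" if "r \<le> c" for c
      by (rule abs_integral_sin_le[OF _ that]) simp
  qed (use assms in auto)
  also have "\<dots> \<le> 1 / r * (1 / (2 * real h))"
  proof (intro mult_mono)
    show "1 / sin (pi * r) \<le> 1 / r" using sin_pi_ge[of r] assms by (intro divide_left_mono) auto
    have "(2 * real h + 1) * 3 \<le> ?l" using pi_gt3 by (intro mult_left_mono) auto
    then have "4 * real h \<le> ?l" by simp
    then show "2 / ?l \<le> 1 / (2 * real h)" using assms(3) by (simp add: divide_simps)
  qed (use assms in auto)
  finally have tail: "integral {r..1/2} ?D \<le> 1 / (2 * (real h * r))" by (simp add: mult_ac abs_le_iff)
  have "integral {-1/2..-r} ?D + integral {-r..1/2} ?D = integral {-1/2..1/2} ?D"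
    by (rule Henstock_Kurzweil_Integration.integral_combine) (use assms int in auto)
  moreover have "integral {-r..r} ?D + integral {r..1/2} ?D = integral {-r..1/2} ?D"
    by (rule Henstock_Kurzweil_Integration.integral_combine) (use assms int in auto)
  moreover have "integral {-1/2..-r} ?D = integral {r..1/2} ?D"
    using Henstock_Kurzweil_Integration.integral_reflect_real[of "1/2" r ?D] by (simp add: even)
  ultimately show ?thesis
    using tail integral_dirichlet_kernel_unit[of h] by (simp add: field_simps)
qed

text \<open>The terms on either side of \<open>n\<close> form half of a Dirichlet kernel without its
  constant term; the term \<open>m = n\<close> supplies one half to each side.\<close>

lemma sum_cos_interval:
  assumes "int h1 = n - lo" "int h2 = hi - n"
  shows "(\<Sum>m\<in>{lo..hi}. cos (2 * pi * of_int (n - m) * x))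
       = (dirichlet_kernel h1 x + dirichlet_kernel h2 x) / 2"
proof -
  let ?c = "\<lambda>m. cos (2 * pi * of_int (n - m) * x)"
  have "(\<Sum>m\<in>{lo..hi}. ?c m) = (\<Sum>m\<in>{lo..<n}. ?c m) + (\<Sum>m\<in>{n}. ?c m) + (\<Sum>m\<in>{n<..hi}. ?c m)"
  proof -
    have "{lo..hi} = {lo..<n} \<union> {n} \<union> {n<..hi}" using assms by auto
    moreover have "sum ?c ({lo..<n} \<union> {n} \<union> {n<..hi}) = sum ?c ({lo..<n} \<union> {n}) + sum ?c {n<..hi}"
      by (rule sum.union_disjoint) auto
    moreover have "sum ?c ({lo..<n} \<union> {n}) = sum ?c {lo..<n} + sum ?c {n}"
      by (rule sum.union_disjoint) auto
    ultimately show ?thesis by simp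
  qed
  also have "(\<Sum>m\<in>{lo..<n}. ?c m) = (\<Sum>j=1..h1. cos (2 * pi * real j * x))"
    by (rule sum.reindex_bij_witness[of _ "\<lambda>j. n - int j" "\<lambda>m. nat (n - m)"]) (use assms in auto)
  also have "(\<Sum>m\<in>{n<..hi}. ?c m) = (\<Sum>j=1..h2. cos (2 * pi * real j * x))"
  proof (rule sum.reindex_bij_witness[of _ "\<lambda>j. n + int j" "\<lambda>m. nat (m - n)"])
    fix m assume "m \<in> {n<..hi}"
    then have "2 * pi * real (nat (m - n)) * x = - (2 * pi * of_int (n - m) * x)"
      by (simp add: algebra_simps)
    then show "cos (2 * pi * real (nat (m - n)) * x) = ?c m" by (simp only: cos_minus)
  qed (use assms in auto)
  finally show ?thesis by (simp add: dirichlet_kernel_def)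
qed

section \<open>Energies of arcs and the mean-square distance to an interval\<close>

lemma arc_energy_nonneg: "arc_energy Z r \<ge> 0"
  unfolding arc_energy_def
  by (intro integral_nonneg integrable_continuous_real continuous_intros) auto

lemma arc_energy_mono:
  assumes "r \<le> s"
  shows "arc_energy Z r \<le> arc_energy Z s"
  unfolding arc_energy_def
  by (intro integral_subset_le integrable_continuous_real continuous_intros) (use assms in auto)

lemma arc_energy_le_card:
  assumes "finite Z" "r \<le> 1 / 2"
  shows "arc_energy Z r \<le> real (card Z)"
proof -
  have "arc_energy Z (1 / 2) = real (card Z)"
    unfolding arc_energy_def
    using has_integral_norm_expsum_sq_unit[OF assms(1), of "-1/2"] by (intro integral_unique) simp
  then show ?thesis using arc_energy_mono[OF assms(2), of Z] by simp
qed

lemma Re_expsum_inner: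
  "Re (expsum Z x * cnj (expsum Y x)) = (\<Sum>n\<in>Z. \<Sum>m\<in>Y. cos (2 * pi * of_int (n - m) * x))"
proof -
  have "expsum Z x * cnj (expsum Y x) = (\<Sum>n\<in>Z. \<Sum>m\<in>Y. cis (2 * pi * of_int (n - m) * x))"
    unfolding expsum_def sum_distrib_left sum_distrib_right cnj_sum
    by (subst sum.swap) (simp add: cis_cnj cis_mult algebra_simps)
  then show ?thesis by (simp only: Re_sum cis.sel)
qed

text \<open>
  The widening by \<open>H\<close> on both sides makes the Dirichlet kernel, integrated over the arc only, have
  almost full mass at every point of the original interval.
\<close>

definition widen :: "int \<Rightarrow> nat \<Rightarrow> nat \<Rightarrow> int set" where
  "widen M N H = {M - int H..M + int N + int H}"

lemma finite_widen [simp]: "finite (widen M N H)"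
  by (simp add: widen_def)

lemma card_widen: "card (widen M N H) = N + 2 * H + 1"
  by (simp add: widen_def)

lemma integral_inner_widen_ge:
  assumes Z: "Z \<subseteq> {M..M + int N}" and r: "0 < r" "r \<le> 1 / 2" and H: "H \<ge> 1"
  shows "integral {-r..r} (\<lambda>x. Re (expsum Z x * cnj (expsum (widen M N H) x)))
     \<ge> real (card Z) * (1 - 1 / (real H * r))"
proof -
  have fin: "finite Z" using Z by (rule finite_subset) simp
  define h1 h2 where "h1 n = nat (n - (M - int H))" and "h2 n = nat (M + int N + int H - n)" for n
  have h: "int (h1 n) = n - (M - int H)" "int (h2 n) = M + int N + int H - n" "H \<le> h1 n" "H \<le> h2 n"
    if "n \<in> Z" for n
    using Z that by (auto simp: h1_def h2_def le_nat_iff)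
  have int: "(\<lambda>x. (dirichlet_kernel (h1 n) x + dirichlet_kernel (h2 n) x) / 2) integrable_on {-r..r}" for n
    by (intro integrable_continuous_real continuous_intros continuous_on_dirichlet_kernel) simp
  have J: "integral {-r..r} (dirichlet_kernel k) \<ge> 1 - 1 / (real H * r)" if "H \<le> k" for k
  proof -
    have "real H * r \<le> real k * r" using that r by (intro mult_right_mono) auto
    moreover have "0 < real H * r" using H r by simp
    ultimately have "1 / (real k * r) \<le> 1 / (real H * r)" by (intro divide_left_mono) auto
    then show ?thesis using integral_dirichlet_kernel_ge[OF r, of k] that H by simp
  qed
  have "real (card Z) * (1 - 1 / (real H * r)) = (\<Sum>n\<in>Z. 1 - 1 / (real H * r))" by simp
  also have "\<dots> \<le> (\<Sum>n\<in>Z. integral {-r..r} (\<lambda>x. (dirichlet_kernel (h1 n) x + dirichlet_kernel (h2 n) x) / 2))"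
  proof (rule sum_mono)
    fix n assume n: "n \<in> Z"
    have eq: "integral {-r..r} (\<lambda>x. (dirichlet_kernel (h1 n) x + dirichlet_kernel (h2 n) x) / 2)
        = (integral {-r..r} (dirichlet_kernel (h1 n)) + integral {-r..r} (dirichlet_kernel (h2 n))) / 2"
      by (subst integral_divide, subst Henstock_Kurzweil_Integration.integral_add)
        (auto intro!: integrable_continuous_real continuous_on_dirichlet_kernel)
    have mean: "c \<le> (a + b) / 2" if "c \<le> a" "c \<le> b" for a b c :: real using that by simp
    show "1 - 1 / (real H * r)
        \<le> integral {-r..r} (\<lambda>x. (dirichlet_kernel (h1 n) x + dirichlet_kernel (h2 n) x) / 2)"
      unfolding eq by (intro mean J h n)
  qed
  also have "\<dots> = integral {-r..r} (\<lambda>x. \<Sum>n\<in>Z. (dirichlet_kernel (h1 n) x + dirichlet_kernel (h2 n) x) / 2)"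
    by (rule integral_sum[symmetric]) (use fin int in auto)
  also have "(\<lambda>x. \<Sum>n\<in>Z. (dirichlet_kernel (h1 n) x + dirichlet_kernel (h2 n) x) / 2)
      = (\<lambda>x. Re (expsum Z x * cnj (expsum (widen M N H) x)))"
  proof
    fix x
    show "(\<Sum>n\<in>Z. (dirichlet_kernel (h1 n) x + dirichlet_kernel (h2 n) x) / 2)
        = Re (expsum Z x * cnj (expsum (widen M N H) x))"
      unfolding Re_expsum_inner widen_def
      by (rule sum.cong[OF refl], rule sum_cos_interval[symmetric]) (use h in auto)
  qed
  finally show ?thesis .
qed

text \<open>For finite nonempty \<open>Y\<close> the scaling factor makes the two exponential sums
  agree at frequency 0.\<close>

definition discrepancy :: "int set \<Rightarrow> int set \<Rightarrow> real \<Rightarrow> real" where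
  "discrepancy Z Y r = integral {-r..r}
     (\<lambda>x. (norm (expsum Z x - of_real (real (card Z) / real (card Y)) * expsum Y x))\<^sup>2)"

lemma discrepancy_nonneg: "discrepancy Z Y r \<ge> 0"
  unfolding discrepancy_def
  by (intro integral_nonneg integrable_continuous_real continuous_intros) auto

lemma norm_diff_scaled_sq:
  "(norm (s - of_real t * u))\<^sup>2 = (norm s)\<^sup>2 - 2 * t * Re (s * cnj u) + t\<^sup>2 * (norm u)\<^sup>2" for s u :: complex
  unfolding cmod_power2 by (simp add: power2_eq_square algebra_simps)

text \<open>With \<open>t = P / n'\<close> the expanded square contains
  \<open>- 2 * t * P + t^2 * n' = - P^2 / n'\<close>: the kernel estimate gives the cross term, and
  the energy of the interval is at most its cardinality \<open>n'\<close>. Hence an energy close to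
  its lower bound forces a small discrepancy.\<close>

lemma discrepancy_le:
  assumes Z: "Z \<subseteq> {M..M + int N}" and r: "0 < r" "r \<le> 1 / 2" and H: "H \<ge> 1"
  shows "discrepancy Z (widen M N H) r
     \<le> arc_energy Z r - (real (card Z))\<^sup>2 / real (N + 2 * H + 1) * (1 - 2 / (real H * r))"
proof -
  define Y P n' t where "Y = widen M N H" and "P = real (card Z)" and "n' = real (N + 2 * H + 1)"
    and "t = P / n'"
  have n': "n' > 0" "real (card Y) = n'" by (simp_all add: n'_def Y_def card_widen)
  have t: "t \<ge> 0" unfolding t_def P_def using n' by simp
  have cont: "continuous_on {-r..r} (\<lambda>x. (norm (expsum Z x))\<^sup>2)"
    "continuous_on {-r..r} (\<lambda>x. (norm (expsum Y x))\<^sup>2)"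
    "continuous_on {-r..r} (\<lambda>x. Re (expsum Z x * cnj (expsum Y x)))"
    by (intro continuous_intros)+
  note int = cont[THEN integrable_continuous_real]
  have "((\<lambda>x. (norm (expsum Z x))\<^sup>2 - 2 * t * Re (expsum Z x * cnj (expsum Y x)) + t\<^sup>2 * (norm (expsum Y x))\<^sup>2)
     has_integral arc_energy Z r - 2 * t * integral {-r..r} (\<lambda>x. Re (expsum Z x * cnj (expsum Y x)))
       + t\<^sup>2 * arc_energy Y r) {-r..r}"
    unfolding arc_energy_def
    by (intro has_integral_add has_integral_diff has_integral_mult_right integrable_integral int)
  then have "discrepancy Z Y r = arc_energy Z r
      - 2 * t * integral {-r..r} (\<lambda>x. Re (expsum Z x * cnj (expsum Y x))) + t\<^sup>2 * arc_energy Y r"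
    unfolding discrepancy_def n'(2) P_def[symmetric] t_def[symmetric] norm_diff_scaled_sq
    by (rule integral_unique)
  also have "\<dots> \<le> arc_energy Z r - 2 * t * (P * (1 - 1 / (real H * r))) + t\<^sup>2 * n'"
  proof -
    have "t * (P * (1 - 1 / (real H * r))) \<le> t * integral {-r..r} (\<lambda>x. Re (expsum Z x * cnj (expsum Y x)))"
      unfolding P_def Y_def by (intro mult_left_mono integral_inner_widen_ge Z r H t)
    moreover have "t\<^sup>2 * arc_energy Y r \<le> t\<^sup>2 * n'"
      using arc_energy_le_card[of Y r] r n' by (intro mult_left_mono) (auto simp: Y_def)
    ultimately show ?thesis by simp
  qed
  also have "\<dots> = arc_energy Z r - P\<^sup>2 / n' * (1 - 2 / (real H * r))"
    unfolding t_def using n'(1) H r by (simp add: field_simps power2_eq_square)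
  finally show ?thesis unfolding Y_def P_def n'_def .
qed

lemma arc_energy_ge:
  assumes "Z \<subseteq> {M..M + int N}" "0 < r" "r \<le> 1 / 2" "H \<ge> 1"
  shows "arc_energy Z r \<ge> (real (card Z))\<^sup>2 / real (N + 2 * H + 1) * (1 - 2 / (real H * r))"
  using discrepancy_le[OF assms] discrepancy_nonneg[of Z "widen M N H" r] by linarith

lemma norm_sq_perturb:
  fixes s u :: complex
  assumes "0 < e" "e < 1"
  shows "(norm s)\<^sup>2 \<ge> (1 - e) * (norm u)\<^sup>2 - (1 / e) * (norm (s - u))\<^sup>2"
proof -
  define a b where "a = norm s" and "b = norm (s - u)"
  have "(norm u)\<^sup>2 \<le> (a + b)\<^sup>2"
    unfolding a_def b_def using norm_triangle_ineq[of s "u - s"]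
    by (intro power_mono) (auto simp: norm_minus_commute)
  then have "(1 - e) * (norm u)\<^sup>2 \<le> (1 - e) * (a + b)\<^sup>2"
    using assms by (intro mult_left_mono) auto
  \<comment> \<open>Completing the square: the cross term \<open>2 * a * b\<close> is absorbed at
    the price of a factor \<open>1 / e\<close> on the square of \<open>b\<close>.\<close>
  also have "\<dots> = a\<^sup>2 + (1 / e) * b\<^sup>2 - b\<^sup>2 - (1 / e) * (e * a - (1 - e) * b)\<^sup>2"
    using assms by (simp add: field_simps power2_eq_square)
  also have "\<dots> \<le> a\<^sup>2 + (1 / e) * b\<^sup>2"
  proof -
    have "0 \<le> (1 / e) * (e * a - (1 - e) * b)\<^sup>2" using assms by simp
    then show ?thesis using zero_le_power2[of b] by linarith
  qed
  finally show ?thesis unfolding a_def b_def by simp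
qed

text \<open>The discrepancy grows with the arc, and at radius \<open>s\<close> it is controlled by
  the excess of the energy. So a single upper bound, at \<open>s\<close>, yields lower bounds at all
  smaller radii.\<close>

lemma arc_energy_ge_interval:
  assumes Z: "Z \<subseteq> {M..M + int N}" and r: "0 < r" "r \<le> s" "s \<le> 1 / 2" and H: "H \<ge> 1"
    and e: "0 < e" "e < 1"
  shows "arc_energy Z r \<ge> (1 - e) * (real (card Z) / real (N + 2 * H + 1))\<^sup>2 * arc_energy (widen M N H) r
     - (1 / e) * (arc_energy Z s - (real (card Z))\<^sup>2 / real (N + 2 * H + 1) * (1 - 2 / (real H * s)))"
proof -
  define Y t where "Y = widen M N H" and "t = real (card Z) / real (N + 2 * H + 1)"
  have t: "real (card Z) / real (card Y) = t" by (simp add: Y_def t_def card_widen)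
  let ?d = "\<lambda>x. (norm (expsum Z x - of_real t * expsum Y x))\<^sup>2"
  have "discrepancy Z Y r \<le> discrepancy Z Y s"
    unfolding discrepancy_def
    by (intro integral_subset_le integrable_continuous_real continuous_intros) (use r in auto)
  also have "\<dots> \<le> arc_energy Z s - (real (card Z))\<^sup>2 / real (N + 2 * H + 1) * (1 - 2 / (real H * s))"
    unfolding Y_def using r by (intro discrepancy_le Z H) auto
  finally have d: "(1 / e) * discrepancy Z Y r
     \<le> (1 / e) * (arc_energy Z s - (real (card Z))\<^sup>2 / real (N + 2 * H + 1) * (1 - 2 / (real H * s)))"
    using e by (intro mult_left_mono) auto
  have ci: "continuous_on {-r..r} ?d" "continuous_on {-r..r} (\<lambda>x. (norm (expsum Y x))\<^sup>2)"
     "continuous_on {-r..r} (\<lambda>x. (norm (expsum Z x))\<^sup>2)"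
    by (intro continuous_intros)+
  note int = ci[THEN integrable_continuous_real]
  have h: "((\<lambda>x. (1 - e) * (t\<^sup>2 * (norm (expsum Y x))\<^sup>2) - (1 / e) * ?d x) has_integral
      (1 - e) * (t\<^sup>2 * arc_energy Y r) - (1 / e) * discrepancy Z Y r) {-r..r}"
    unfolding arc_energy_def discrepancy_def t
    by (intro has_integral_diff has_integral_mult_right integrable_integral int)
  have "(1 - e) * (t\<^sup>2 * arc_energy Y r) - (1 / e) * discrepancy Z Y r \<le> arc_energy Z r"
  proof (rule has_integral_le[OF h])
    show "((\<lambda>x. (norm (expsum Z x))\<^sup>2) has_integral arc_energy Z r) {-r..r}"
      unfolding arc_energy_def by (rule integrable_integral[OF int(3)])
    show "(1 - e) * (t\<^sup>2 * (norm (expsum Y x))\<^sup>2) - (1 / e) * ?d x \<le> (norm (expsum Z x))\<^sup>2" for x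
      using norm_sq_perturb[OF e, of "of_real t * expsum Y x" "expsum Z x"]
      by (simp add: norm_mult power_mult_distrib)
  qed
  then show ?thesis using d unfolding Y_def t_def by (simp only: mult.assoc)
qed

subsection \<open>Mean square of the exponential sum of an interval on a short arc\<close>

lemma cos_le_Taylor:
  assumes "\<And>t. cos (t + 1 / 2 * real n * pi) * x ^ n \<le> x ^ n"
  shows "cos x \<le> (\<Sum>m<n. cos_coeff m * x ^ m) + x ^ n / fact n"
proof -
  obtain t where "cos x = (\<Sum>m<n. cos_coeff m * x ^ m) + cos (t + 1 / 2 * real n * pi) / fact n * x ^ n"
    using Maclaurin_cos_expansion[of x n] by auto
  moreover have "cos (t + 1 / 2 * real n * pi) * x ^ n / fact n \<le> x ^ n / fact n"
    by (intro divide_right_mono assms) simp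
  ultimately show ?thesis by simp
qed

lemma cos_mult_even_power_le:
  assumes "even n"
  shows "cos t * x ^ n \<le> (x::real) ^ n"
  using mult_right_mono[OF cos_le_one[of t], of "x ^ n"] assms by (simp add: zero_le_even_power)

lemma cos_le_quartic: "cos x \<le> 1 - x ^ 2 / 2 + x ^ 4 / (24::real)"
proof -
  have "(\<Sum>m<4. cos_coeff m * x ^ m) = 1 - x ^ 2 / 2"
    by (simp add: lessThan_nat_numeral cos_coeff_def fact_numeral)
  moreover have "fact 4 = (24::real)" by (simp add: fact_numeral)
  ultimately show ?thesis
    using cos_le_Taylor[of 4 x] cos_mult_even_power_le[of 4] by simp
qed

lemma cos_le_octic: "cos x \<le> 1 - x ^ 2 / 2 + x ^ 4 / 24 - x ^ 6 / 720 + x ^ 8 / (40320::real)"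
proof -
  have "(\<Sum>m<8. cos_coeff m * x ^ m) = 1 - x ^ 2 / 2 + x ^ 4 / 24 - x ^ 6 / 720"
    by (simp add: lessThan_nat_numeral cos_coeff_def fact_numeral)
  moreover have "fact 8 = (40320::real)" by (simp add: fact_numeral)
  ultimately show ?thesis
    using cos_le_Taylor[of 8 x] cos_mult_even_power_le[of 8] by simp
qed

text \<open>The double-angle formula reduces this to an upper Taylor bound for the cosine, cut off
  at an even power so that the remainder has a definite sign.\<close>

lemma sin_sq_ge_Taylor: "(sin z)\<^sup>2 \<ge> z\<^sup>2 * (1 - z ^ 2 / 3 + 2 * z ^ 4 / 45 - z ^ 6 / (315::real))"
proof -
  have "(sin z)\<^sup>2 = (1 - cos (2 * z)) / 2" by (simp add: cos_double_sin)
  moreover have "cos (2 * z) \<le> 1 - 2 * z ^ 2 + 2 * z ^ 4 / 3 - 4 * z ^ 6 / 45 + 2 * z ^ 8 / 315"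
    using cos_le_octic[of "2 * z"] by (simp add: power_mult_distrib)
  moreover have "z\<^sup>2 * (1 - z ^ 2 / 3 + 2 * z ^ 4 / 45 - z ^ 6 / 315)
      = z ^ 2 - z ^ 4 / 3 + 2 * z ^ 6 / 45 - z ^ 8 / 315"
    by (simp add: algebra_simps power_add[symmetric])
  ultimately show ?thesis by simp
qed

lemma norm_cis_minus_one_sq: "(norm (cis (2 * t) - 1))\<^sup>2 = 4 * (sin t)\<^sup>2"
proof -
  have "(norm (cis (2 * t) - 1))\<^sup>2 = (cos (2 * t) - 1)\<^sup>2 + (sin (2 * t))\<^sup>2"
    by (simp add: cmod_power2)
  also have "\<dots> = 2 - 2 * cos (2 * t)"
    using sin_cos_squared_add[of "2 * t"] by (simp add: power2_eq_square algebra_simps)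
  finally show ?thesis by (simp add: cos_double_sin)
qed

lemma expsum_interval_sin:
  "(norm (expsum {lo..<lo + int n} x))\<^sup>2 * (sin (pi * x))\<^sup>2 = (sin (pi * real n * x))\<^sup>2"
proof -
  define w where "w = cis (2 * pi * x)"
  have "expsum {lo..<lo + int n} x = (\<Sum>j<n. cis (2 * pi * of_int lo * x) * w ^ j)"
    unfolding expsum_def
  proof (rule sum.reindex_bij_witness[of _ "\<lambda>j. lo + int j" "\<lambda>m. nat (m - lo)"])
    fix m assume m: "m \<in> {lo..<lo + int n}"
    have "w ^ nat (m - lo) = cis (real (nat (m - lo)) * (2 * pi * x))"
      unfolding w_def by (rule Complex.DeMoivre)
    then show "cis (2 * pi * of_int lo * x) * w ^ nat (m - lo) = cis (2 * pi * of_int m * x)"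
      using m by (simp add: cis_mult algebra_simps)
  qed auto
  then have E: "expsum {lo..<lo + int n} x = cis (2 * pi * of_int lo * x) * (\<Sum>j<n. w ^ j)"
    by (simp add: sum_distrib_left)
  have "(\<Sum>j<n. w ^ j) * (w - 1) = w ^ n - 1"
    by (metis mult.commute power_diff_1_eq)
  then have "expsum {lo..<lo + int n} x * (w - 1) = cis (2 * pi * of_int lo * x) * (w ^ n - 1)"
    unfolding E by simp
  then have "norm (expsum {lo..<lo + int n} x) * norm (w - 1) = norm (w ^ n - 1)"
    by (metis norm_mult norm_cis mult_1)
  then have "(norm (expsum {lo..<lo + int n} x))\<^sup>2 * (norm (w - 1))\<^sup>2 = (norm (w ^ n - 1))\<^sup>2"
    by (metis power_mult_distrib)
  moreover have "(norm (w - 1))\<^sup>2 = 4 * (sin (pi * x))\<^sup>2"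
    unfolding w_def using norm_cis_minus_one_sq[of "pi * x"] by (simp add: mult.assoc)
  moreover have "(norm (w ^ n - 1))\<^sup>2 = 4 * (sin (pi * real n * x))\<^sup>2"
    unfolding w_def Complex.DeMoivre using norm_cis_minus_one_sq[of "pi * real n * x"]
    by (simp add: mult_ac)
  ultimately show ?thesis by simp
qed

text \<open>In the closed form the denominator \<open>sin (pi * x)\<close> is replaced by the larger
  \<open>pi * x\<close> in absolute value, and the numerator by its Taylor polynomial.\<close>

lemma expsum_interval_ge:
  fixes x :: real and n :: nat
  assumes "\<bar>x\<bar> \<le> 1 / 2"
  defines "z \<equiv> pi * real n * x"
  shows "(norm (expsum {lo..<lo + int n} x))\<^sup>2
     \<ge> (real n)\<^sup>2 * (1 - z ^ 2 / 3 + 2 * z ^ 4 / 45 - z ^ 6 / 315)"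
proof (cases "x = 0")
  case True
  then show ?thesis by (simp add: z_def expsum_def)
next
  case False
  have s: "(sin (pi * x))\<^sup>2 > 0"
  proof -
    have "sin (pi * \<bar>x\<bar>) > 0" using sin_pi_ge[of "\<bar>x\<bar>"] False assms(1) by auto
    then have "sin (pi * x) \<noteq> 0" by (cases "x \<ge> 0") auto
    then show ?thesis by simp
  qed
  have "(norm (expsum {lo..<lo + int n} x))\<^sup>2 = (sin z)\<^sup>2 / (sin (pi * x))\<^sup>2"
    using expsum_interval_sin[of lo n x] s unfolding z_def by (simp add: field_simps)
  also have "\<dots> \<ge> (sin z)\<^sup>2 / (pi * x)\<^sup>2"
  proof (rule divide_left_mono)
    show "(sin (pi * x))\<^sup>2 \<le> (pi * x)\<^sup>2"
      using abs_sin_x_le_abs_x[of "pi * x"] by (metis abs_le_square_iff)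
  qed (use s False in auto)
  also have "(sin z)\<^sup>2 / (pi * x)\<^sup>2 \<ge> z\<^sup>2 * (1 - z ^ 2 / 3 + 2 * z ^ 4 / 45 - z ^ 6 / 315) / (pi * x)\<^sup>2"
    by (intro divide_right_mono sin_sq_ge_Taylor) simp
  also have "z\<^sup>2 * (1 - z ^ 2 / 3 + 2 * z ^ 4 / 45 - z ^ 6 / 315) / (pi * x)\<^sup>2
      = (real n)\<^sup>2 * (1 - z ^ 2 / 3 + 2 * z ^ 4 / 45 - z ^ 6 / 315)"
    using False by (simp add: z_def power_mult_distrib)
  finally show ?thesis .
qed

section \<open>The polynomial inequality behind the constant 0.143\<close>

lemma polynomial_margin_small:
  fixes y :: real
  assumes "0 \<le> y" "y \<le> 0.45"
  shows "(143/1000) - y + 2 * y\<^sup>2 - (10967/5000) * y ^ 4 \<ge> 0"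
proof -
  \<comment> \<open>First-order Taylor expansion at 0.32 with the remainder factored. The point lies
    close to a minimum, so the tangent is nearly flat and stays positive on the whole range.\<close>
  have "(143/1000) - y + 2 * y\<^sup>2 - (10967/5000) * y ^ 4
     = (y - 0.32)\<^sup>2 * (2 - (10967/5000) * (y\<^sup>2 + 0.64 * y + 0.3072))
       + ((143/1000) - 0.32 + 2 * 0.1024 - (10967/5000) * 0.01048576 + (-1 + 1.28 - 4 * (10967/5000) * 0.032768) * (y - 0.32))"
    by (simp add: power2_eq_square eval_nat_numeral field_simps)
  moreover have "y\<^sup>2 \<le> 0.45 * 0.45" unfolding power2_eq_square using assms by (intro mult_mono) auto
  then have "(y - 0.32)\<^sup>2 * (2 - (10967/5000) * (y\<^sup>2 + 0.64 * y + 0.3072)) \<ge> 0"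
    using assms by (intro mult_nonneg_nonneg) auto
  ultimately show ?thesis using assms by simp
qed


text \<open>
  On each interval the powers of \<open>w = y\<^sup>2\<close> are replaced by quadratic bounds (a tangent at
  \<open>s\<close> for \<open>y\<close>, a tangent at \<open>m\<close> for \<open>w ^ 3\<close>), after which the end points decide.
\<close>

lemma polynomial_margin_aux:
  fixes y :: real
  defines "w \<equiv> y\<^sup>2"
  assumes w: "a \<le> w" "w \<le> b" and s: "s > 0" and m: "m \<ge> 0"
  shows "(143/1000) - y + 2 * y\<^sup>2 - (10967/5000) * y ^ 4 + (8659/5000) * y ^ 6 - (4361/5000) * y ^ 8
    \<ge> (143/1000) - s / 2 - (8659/5000) * 2 * m ^ 3 + (2 - 1 / (2 * s) + (8659/5000) * 3 * m\<^sup>2) * w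
       - ((10967/5000) + (4361/5000) * b\<^sup>2) * ((a + b) * w - a * b)"
proof -
  have w0: "w \<ge> 0" by (simp add: w_def)
  have "0 \<le> (y - s)\<^sup>2 / (2 * s)" using s by simp
  then have 1: "y \<le> s / 2 + 1 / (2 * s) * w"
    using s by (simp add: w_def power2_eq_square field_simps)
  have "0 \<le> (w - m)\<^sup>2 * (w + 2 * m)" using w0 m by simp
  then have 2: "w ^ 3 \<ge> 3 * m\<^sup>2 * w - 2 * m ^ 3"
    by (simp add: power2_eq_square power3_eq_cube algebra_simps)
  have "w\<^sup>2 \<le> b\<^sup>2" using w w0 by (intro power_mono) auto
  then have 3: "w ^ 4 \<le> b\<^sup>2 * w\<^sup>2"
    using mult_right_mono[of "w\<^sup>2" "b\<^sup>2" "w\<^sup>2"] by (simp add: power_add[symmetric])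
  have "0 \<le> (w - a) * (b - w)" using w by simp
  then have "w\<^sup>2 \<le> (a + b) * w - a * b" by (simp add: power2_eq_square algebra_simps)
  then have 4: "((10967/5000) + (4361/5000) * b\<^sup>2) * w\<^sup>2 \<le> ((10967/5000) + (4361/5000) * b\<^sup>2) * ((a + b) * w - a * b)"
    by (intro mult_left_mono) auto
  have "y ^ 4 = w\<^sup>2" "y ^ 6 = w ^ 3" "y ^ 8 = w ^ 4" by (simp_all add: w_def flip: power_mult)
  moreover have "(2 - 1 / (2 * s) + (8659/5000) * 3 * m\<^sup>2) * w = 2 * w - 1 / (2 * s) * w + (8659/5000) * (3 * m\<^sup>2 * w)"
    by (simp add: algebra_simps)
  moreover have "((10967/5000) + (4361/5000) * b\<^sup>2) * w\<^sup>2 = (10967/5000) * w\<^sup>2 + (4361/5000) * (b\<^sup>2 * w\<^sup>2)"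
    by (simp add: algebra_simps)
  ultimately show ?thesis using 1 2 3 4 unfolding w_def[symmetric] by linarith
qed

lemma polynomial_margin_large:
  fixes y :: real
  assumes "0.45 \<le> y" "y \<le> 0.8"
  shows "(143/1000) - y + 2 * y\<^sup>2 - (10967/5000) * y ^ 4 + (8659/5000) * y ^ 6 - (4361/5000) * y ^ 8 \<ge> 0"
proof -
  have w: "0.45 * 0.45 \<le> y\<^sup>2" "y\<^sup>2 \<le> 0.8 * 0.8"
    unfolding power2_eq_square using assms by (intro mult_mono; auto)+
  \<comment> \<open>The break points are the squares of 0.45, 0.6, 0.7 and 0.8. In each range
    \<open>m\<close> is taken near the midpoint for \<open>w\<close>, and \<open>s\<close> within
    the corresponding range for \<open>y\<close>.\<close>
  consider "0.2025 \<le> y\<^sup>2" "y\<^sup>2 \<le> 0.36" | "0.36 \<le> y\<^sup>2" "y\<^sup>2 \<le> 0.49" | "0.49 \<le> y\<^sup>2" "y\<^sup>2 \<le> 0.64"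
    using w by fastforce
  then show ?thesis
  proof cases
    case 1
    show ?thesis
      by (rule order_trans[OF _ polynomial_margin_aux[OF 1, of "0.5" "0.28"]])
        (use 1 in \<open>simp_all add: power2_eq_square power3_eq_cube\<close>)
  next
    case 2
    show ?thesis
      by (rule order_trans[OF _ polynomial_margin_aux[OF 2, of "0.7" "0.42"]])
        (use 2 in \<open>simp_all add: power2_eq_square power3_eq_cube\<close>)
  next
    case 3
    show ?thesis
      by (rule order_trans[OF _ polynomial_margin_aux[OF 3, of "0.7" "0.56"]])
        (use 3 in \<open>simp_all add: power2_eq_square power3_eq_cube\<close>)
  qed
qed

lemma polynomial_margin:
  fixes y :: real
  assumes "0 \<le> y" "y \<le> 4 / 5"
  shows "(143/1000) - y + 2 * y\<^sup>2 - (10967/5000) * y ^ 4 + (8659/5000) * y ^ 6 - (4361/5000) * y ^ 8 \<ge> 0"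
proof (cases "y \<le> 0.45")
  case True
  have "y ^ 8 \<le> y ^ 6" using assms by (intro power_decreasing) auto
  moreover have "0 \<le> y ^ 6" using assms by simp
  ultimately have "0 \<le> (8659/5000) * y ^ 6 - (4361/5000) * y ^ 8" by linarith
  then show ?thesis using polynomial_margin_small[OF assms(1) True] by simp
qed (use polynomial_margin_large assms in auto)

text \<open>This allows \<open>pi^2\<close> to be replaced by 987/100. Completing the square in
  \<open>V + v\<close>, with minimum at 196/15, shows that the difference quotient is a sum of
  squares plus a positive constant.\<close>

lemma bracket_antimono:
  fixes v V :: real
  assumes "v \<le> V"
  shows "1 - v / 9 + 2 * v\<^sup>2 / 225 - v ^ 3 / 2205 \<ge> 1 - V / 9 + 2 * V\<^sup>2 / 225 - V ^ 3 / 2205"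
proof -
  have "(1 - v / 9 + 2 * v\<^sup>2 / 225 - v ^ 3 / 2205) - (1 - V / 9 + 2 * V\<^sup>2 / 225 - V ^ 3 / 2205)
     = (V - v) * (1 / 9 - 2 * (V + v) / 225 + (V\<^sup>2 + V * v + v\<^sup>2) / 2205)"
    by (simp add: power2_eq_square power3_eq_cube field_simps)
  also have "1 / 9 - 2 * (V + v) / 225 + (V\<^sup>2 + V * v + v\<^sup>2) / 2205
     = ((V - v)\<^sup>2 + 3 * (V + v - 98 / 15 * 2)\<^sup>2) / 8820 + (1 / 9 - 3 * (98 / 15 * 2)\<^sup>2 / 8820)"
    by (simp add: power2_eq_square field_simps)
  also have "(V - v) * \<dots> \<ge> 0"
    using assms by (intro mult_nonneg_nonneg add_nonneg_nonneg) (auto simp: power2_eq_square)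
  finally show ?thesis by simp
qed

text \<open>Integrating the Taylor bound and multiplying by \<open>r\<close> leaves a polynomial
  inequality in \<open>y = n * r\<close> alone. With 9.87 for \<open>pi^2\<close>, the coefficients
  \<open>2 * 9.87 / 9\<close>, \<open>4 * 9.87^2 / 225\<close> and \<open>2 * 9.87^3 / 2205\<close>
  are rounded in the unfavourable direction to 10967/5000, 8659/5000 and 4361/5000.\<close>

lemma arc_energy_interval_ge_small:
  assumes n: "n \<ge> 1" and r: "0 < r" "r \<le> 1 / 2" and y: "real n * r \<le> 4 / 5"
  shows "arc_energy {lo..<lo + int n} r \<ge> real n - (143/1000) / r"
proof -
  define y where "y = real n * r"
  have y0: "0 < y" "y \<le> 4 / 5" using assms by (simp_all add: y_def)
  define A where "A = (pi * real n)\<^sup>2"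
  let ?F = "\<lambda>x. (real n)\<^sup>2 * (x - A * x ^ 3 / 9 + 2 * A\<^sup>2 * x ^ 5 / 225 - A ^ 3 * x ^ 7 / 2205)"
  let ?f = "\<lambda>x. (real n)\<^sup>2 * (1 - A * x ^ 2 / 3 + 2 * A\<^sup>2 * x ^ 4 / 45 - A ^ 3 * x ^ 6 / 315)"
  have "(?f has_integral (?F r - ?F (- r))) {-r..r}"
    using r by (intro fundamental_theorem_of_calculus)
      (auto intro!: derivative_eq_intros simp: has_real_derivative_iff_has_vector_derivative[symmetric] field_simps)
  then have "?F r - ?F (- r) \<le> arc_energy {lo..<lo + int n} r"
  proof (rule has_integral_le)
    show "((\<lambda>x. (norm (expsum {lo..<lo + int n} x))\<^sup>2) has_integral arc_energy {lo..<lo + int n} r) {-r..r}"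
      unfolding arc_energy_def
      by (intro integrable_integral integrable_continuous_real continuous_intros)
    fix x assume "x \<in> {-r..r}"
    then have "\<bar>x\<bar> \<le> 1 / 2" using r by auto
    from expsum_interval_ge[OF this, of n lo]
    show "?f x \<le> (norm (expsum {lo..<lo + int n} x))\<^sup>2"
      by (simp add: A_def power_mult_distrib mult.assoc flip: power_mult)
  qed
  moreover have "?F r - ?F (- r) = 2 * real n * y * (1 - A * r\<^sup>2 / 9 + 2 * (A * r\<^sup>2)\<^sup>2 / 225 - (A * r\<^sup>2) ^ 3 / 2205)"
    by (simp add: y_def power_mult_distrib power2_eq_square eval_nat_numeral algebra_simps)
  moreover have "A * r\<^sup>2 = pi\<^sup>2 * y\<^sup>2" by (simp add: A_def y_def power_mult_distrib)
  moreover have "1 - pi\<^sup>2 * y\<^sup>2 / 9 + 2 * (pi\<^sup>2 * y\<^sup>2)\<^sup>2 / 225 - (pi\<^sup>2 * y\<^sup>2) ^ 3 / 2205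
      \<ge> 1 - (987/100) * y\<^sup>2 / 9 + 2 * ((987/100) * y\<^sup>2)\<^sup>2 / 225 - ((987/100) * y\<^sup>2) ^ 3 / 2205"
  proof (rule bracket_antimono, rule mult_right_mono)
    have "pi\<^sup>2 \<le> (3.1416)\<^sup>2" using pi_approx by (intro power_mono) auto
    then show "pi\<^sup>2 \<le> (987/100)" by (simp add: power2_eq_square)
  qed simp
  then have "2 * real n * y * (1 - pi\<^sup>2 * y\<^sup>2 / 9 + 2 * (pi\<^sup>2 * y\<^sup>2)\<^sup>2 / 225 - (pi\<^sup>2 * y\<^sup>2) ^ 3 / 2205)
      \<ge> 2 * real n * y * (1 - (987/100) * y\<^sup>2 / 9 + 2 * ((987/100) * y\<^sup>2)\<^sup>2 / 225 - ((987/100) * y\<^sup>2) ^ 3 / 2205)"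
    using y0 by (intro mult_left_mono) auto
  moreover have "2 * real n * y * (1 - (987/100) * y\<^sup>2 / 9 + 2 * ((987/100) * y\<^sup>2)\<^sup>2 / 225 - ((987/100) * y\<^sup>2) ^ 3 / 2205)
      \<ge> real n - (143/1000) / r"
  proof -
    have p: "y ^ 4 \<ge> 0" "y ^ 6 \<ge> 0" "y ^ 8 \<ge> 0" using y0 by auto
    have e: "2 * y\<^sup>2 * (1 - (987/100) * y\<^sup>2 / 9 + 2 * ((987/100) * y\<^sup>2)\<^sup>2 / 225 - ((987/100) * y\<^sup>2) ^ 3 / 2205)
       = 2 * y\<^sup>2 - (2 * (987/100) / 9) * y ^ 4 + (4 * (987/100)\<^sup>2 / 225) * y ^ 6 - (2 * (987/100) ^ 3 / 2205) * y ^ 8"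
      by (simp add: power_mult_distrib power2_eq_square eval_nat_numeral algebra_simps)
    have "(2 * (987/100) / 9) * y ^ 4 \<le> (10967/5000) * y ^ 4" "(4 * (987/100)\<^sup>2 / 225) * y ^ 6 \<ge> (8659/5000) * y ^ 6"
      "(2 * (987/100) ^ 3 / 2205) * y ^ 8 \<le> (4361/5000) * y ^ 8"
      using p by (intro mult_right_mono; simp add: power2_eq_square power3_eq_cube)+
    then have "y - (143/1000) \<le> 2 * y\<^sup>2 * (1 - (987/100) * y\<^sup>2 / 9 + 2 * ((987/100) * y\<^sup>2)\<^sup>2 / 225 - ((987/100) * y\<^sup>2) ^ 3 / 2205)"
      unfolding e using polynomial_margin[of y] y0 by linarith
    then have "(y - (143/1000)) / r \<le> 2 * y\<^sup>2 * (1 - (987/100) * y\<^sup>2 / 9 + 2 * ((987/100) * y\<^sup>2)\<^sup>2 / 225 - ((987/100) * y\<^sup>2) ^ 3 / 2205) / r"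
      using r by (intro divide_right_mono) auto
    moreover have "(y - (143/1000)) / r = real n - (143/1000) / r" using r by (simp add: y_def field_simps)
    moreover have "2 * y\<^sup>2 * c / r = 2 * real n * y * c" for c
      using r by (simp add: y_def power2_eq_square)
    ultimately show ?thesis by simp
  qed
  ultimately show ?thesis by simp
qed

text \<open>By Parseval the whole period carries \<open>card Z\<close>, and the two pieces outside
  the arc agree because conjugation makes the squared norm even.\<close>

lemma arc_energy_reflect:
  assumes "0 < r" "r \<le> 1 / 2" "finite Z"
  shows "arc_energy Z r = real (card Z) - 2 * integral {r..1/2} (\<lambda>x. (norm (expsum Z x))\<^sup>2)"
proof -
  let ?f = "\<lambda>x. (norm (expsum Z x))\<^sup>2"
  have int: "?f integrable_on {a..b}" for a b
    by (intro integrable_continuous_real continuous_intros)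
  have "expsum Z (- x) = cnj (expsum Z x)" for x
    unfolding expsum_def by (simp add: cis_cnj)
  then have even: "?f (- x) = ?f x" for x by simp
  have "integral {-1/2..-r} ?f + integral {-r..1/2} ?f = integral {-1/2..1/2} ?f"
    by (rule Henstock_Kurzweil_Integration.integral_combine) (use assms int in auto)
  moreover have "integral {-r..r} ?f + integral {r..1/2} ?f = integral {-r..1/2} ?f"
    by (rule Henstock_Kurzweil_Integration.integral_combine) (use assms int in auto)
  moreover have "integral {-1/2..-r} ?f = integral {r..1/2} ?f"
    using Henstock_Kurzweil_Integration.integral_reflect_real[of "1/2" r ?f] by (simp only: even) simp
  moreover have "integral {-1/2..1/2} ?f = real (card Z)"
    using has_integral_norm_expsum_sq_unit[OF assms(3), of "-1/2"] by (intro integral_unique) simp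
  ultimately show ?thesis unfolding arc_energy_def by simp
qed

lemma mult_cos_le_sin:
  assumes "0 \<le> z" "z \<le> (1::real)"
  shows "z * cos z \<le> sin z"
proof -
  have "z * cos z \<le> z * (1 - z ^ 2 / 2 + z ^ 4 / 24)"
    by (intro mult_left_mono cos_le_quartic assms)
  also have "\<dots> = z - z ^ 3 / 2 + z ^ 5 / 24" by (simp add: eval_nat_numeral algebra_simps)
  also have "\<dots> \<le> z - z ^ 3 / 6"
    using power_decreasing[of 3 5 z] assms zero_le_power[OF assms(1), of 3] by linarith
  also have "\<dots> \<le> sin z" by (rule sin_ge_cubic[OF assms(1)])
  finally show ?thesis .
qed

text \<open>The primitive is \<open>- cot (pi * x) / pi\<close>, which vanishes at 1/2; at
  \<open>r\<close> the bound comes from \<open>z * cos z\<close> being at most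
  \<open>sin z\<close>.\<close>

lemma integral_inverse_sin_sq_le:
  assumes "0 < r" "r \<le> 1 / 20"
  shows "(\<lambda>x. 1 / (sin (pi * x))\<^sup>2) integrable_on {r..1/2}"
    and "integral {r..1/2} (\<lambda>x. 1 / (sin (pi * x))\<^sup>2) \<le> 1 / (pi\<^sup>2 * r)"
proof -
  let ?F = "\<lambda>x. - (cos (pi * x) / (pi * sin (pi * x)))"
  have pos: "sin (pi * x) > 0" if "r \<le> x" "x \<le> 1 / 2" for x
    using sin_pi_ge[of x] that assms by auto
  have "((\<lambda>x. 1 / (sin (pi * x))\<^sup>2) has_integral (?F (1 / 2) - ?F r)) {r..1/2}"
  proof (rule fundamental_theorem_of_calculus)
    fix x assume "x \<in> {r..1/2}"
    then have s: "sin (pi * x) \<noteq> 0" using pos[of x] by auto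
    have "(?F has_real_derivative ((sin (pi * x))\<^sup>2 + (cos (pi * x))\<^sup>2) / (sin (pi * x))\<^sup>2) (at x within {r..1/2})"
      using s by (auto intro!: derivative_eq_intros simp: field_simps power2_eq_square)
        (use sin_cos_squared_add3[of "pi * x"] in algebra)
    then show "(?F has_vector_derivative 1 / (sin (pi * x))\<^sup>2) (at x within {r..1/2})"
      unfolding sin_cos_squared_add has_real_derivative_iff_has_vector_derivative .
  qed (use assms in auto)
  then have h: "((\<lambda>x. 1 / (sin (pi * x))\<^sup>2) has_integral cos (pi * r) / (pi * sin (pi * r))) {r..1/2}"
    by (simp add: field_simps)
  then show "(\<lambda>x. 1 / (sin (pi * x))\<^sup>2) integrable_on {r..1/2}" by blast
  have "(pi * r) * cos (pi * r) \<le> sin (pi * r)"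
  proof (rule mult_cos_le_sin)
    show "pi * r \<le> 1" using mult_mono[of pi 4 r "1/20"] assms pi_less_4 by simp
  qed (use assms in auto)
  then have "cos (pi * r) / (pi * sin (pi * r)) \<le> 1 / (pi\<^sup>2 * r)"
    using pos[of r] assms by (simp add: field_simps power2_eq_square)
  then show "integral {r..1/2} (\<lambda>x. 1 / (sin (pi * x))\<^sup>2) \<le> 1 / (pi\<^sup>2 * r)"
    using h by (simp add: integral_unique)
qed

text \<open>Here the energy outside the arc is estimated, with the squared sine written as
  \<open>(1 - cos) / 2\<close>. The constant part costs at most \<open>1 / (pi^2 * r)\<close>, about
  \<open>0.1013 / r\<close>; the oscillating part, by the second mean value theorem, at most about
  \<open>0.041 / r\<close>. The sum stays below \<open>0.143 / r\<close>.\<close>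

lemma arc_energy_interval_ge_large:
  assumes n: "n \<ge> 1" and r: "0 < r" "r \<le> 1 / 20" and y: "real n * r \<ge> (4/5)"
  shows "arc_energy {lo..<lo + int n} r \<ge> real n - (143/1000) / r"
proof -
  let ?T = "expsum {lo..<lo + int n}" and ?l = "2 * pi * real n"
  let ?g = "\<lambda>x. 1 / (sin (pi * x))\<^sup>2"
  have pos: "sin (pi * x) > 0" if "r \<le> x" "x \<le> 1 / 2" for x
    using sin_pi_ge[of x] that r by auto
  note gint = integral_inverse_sin_sq_le[OF r]
  have cont: "continuous_on {r..1/2} (\<lambda>x. ?g x * cos (?l * x))"
    by (intro continuous_intros) (use pos in force)
  have "integral {r..1/2} (\<lambda>x. (norm (?T x))\<^sup>2)
      = integral {r..1/2} (\<lambda>x. (?g x - ?g x * cos (?l * x)) / 2)"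
  proof (rule integral_cong)
    fix x assume "x \<in> {r..1/2}"
    then have "sin (pi * x) > 0" using pos by auto
    moreover have "(sin (pi * real n * x))\<^sup>2 = (1 - cos (?l * x)) / 2"
      using cos_double_sin[of "pi * real n * x"] by (simp add: mult.assoc)
    ultimately show "(norm (?T x))\<^sup>2 = (?g x - ?g x * cos (?l * x)) / 2"
      using expsum_interval_sin[of lo n x] by (simp add: field_simps)
  qed
  also have "\<dots> = (integral {r..1/2} ?g - integral {r..1/2} (\<lambda>x. ?g x * cos (?l * x))) / 2"
    by (subst integral_divide, subst Henstock_Kurzweil_Integration.integral_diff)
      (use gint(1) integrable_continuous_real[OF cont] in auto)
  finally have eq: "2 * integral {r..1/2} (\<lambda>x. (norm (?T x))\<^sup>2)
      = integral {r..1/2} ?g - integral {r..1/2} (\<lambda>x. ?g x * cos (?l * x))" by simp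
  have osc: "\<bar>integral {r..1/2} (\<lambda>x. ?g x * cos (?l * x))\<bar> \<le> ?g r * (2 / ?l)"
  proof (rule integral_antimono_mult_le)
    show "(\<lambda>x. cos (?l * x)) integrable_on {r..1/2}"
      by (intro integrable_continuous_real continuous_intros)
    show "?g y \<le> ?g x" if "r \<le> x" "x \<le> y" "y \<le> 1 / 2" for x y
    proof -
      have "(sin (pi * x))\<^sup>2 \<le> (sin (pi * y))\<^sup>2"
        using sin_pi_mono[of x y] pos[of x] that r by (intro power_mono) auto
      then show ?thesis using pos[of x] pos[of y] that by (intro divide_left_mono) auto
    qed
    show "\<bar>integral {r..c} (\<lambda>x. cos (?l * x))\<bar> \<le> 2 / ?l" if "r \<le> c" for c
      by (rule abs_integral_cos_le[OF _ that]) (use n in simp)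
  qed (use r in auto)
  \<comment> \<open>As \<open>r\<close> is at most 1/20, \<open>pi * r\<close> is at most 0.16, and
    the cubic term of the sine costs less than half a per cent.\<close>
  have sin_r: "(sin (pi * r))\<^sup>2 \<ge> (99/100) * (pi * r)\<^sup>2"
  proof -
    have z: "0 \<le> pi * r" "pi * r \<le> (16/100)"
      using r mult_mono[of pi "3.2" r "1/20"] pi_approx by auto
    have "(pi * r)\<^sup>2 \<le> (16/100)\<^sup>2" using z by (intro power_mono) auto
    then have "(pi * r) * (pi * r)\<^sup>2 \<le> (pi * r) * (256/10000)"
      using z by (intro mult_left_mono) (auto simp: power2_eq_square)
    moreover have "(pi * r) ^ 3 = (pi * r) * (pi * r)\<^sup>2" by (simp add: eval_nat_numeral)
    ultimately have "(995/1000) * (pi * r) \<le> sin (pi * r)"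
      using sin_ge_cubic[OF z(1)] z(1) by linarith
    then have "((995/1000) * (pi * r))\<^sup>2 \<le> (sin (pi * r))\<^sup>2"
      using z by (intro power_mono) auto
    moreover have "(99/100) * (pi * r)\<^sup>2 \<le> (995/1000)\<^sup>2 * (pi * r)\<^sup>2"
      by (intro mult_right_mono) (auto simp: power2_eq_square)
    moreover have "((995/1000) * (pi * r))\<^sup>2 = (995/1000)\<^sup>2 * (pi * r)\<^sup>2"
      by (rule power_mult_distrib)
    ultimately show ?thesis by linarith
  qed
  have pi2: "pi\<^sup>2 \<ge> (9869/1000)"
  proof -
    have "(31415/10000)\<^sup>2 \<le> pi\<^sup>2" using pi_approx by (intro power_mono) auto
    then show ?thesis by (simp add: power2_eq_square)
  qed
  have "?g r * (2 / ?l) \<le> 1 / ((99/100) * (pi * r)\<^sup>2) * (2 / ?l)"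
    using sin_r r pos[of r] by (intro mult_right_mono divide_left_mono) (auto intro!: mult_pos_pos)
  also have "\<dots> = 1 / r * (1 / ((99/100) * pi\<^sup>2 * pi * (real n * r)))"
    using r n by (simp add: field_simps power2_eq_square)
  also have "\<dots> \<le> 1 / r * (1 / ((99/100) * (9869/1000) * (31415/10000) * (4/5)))"
    using r y pi2 pi_approx by (intro mult_left_mono divide_left_mono mult_mono) auto
  finally have osc': "?g r * (2 / ?l) \<le> 1 / r * (1 / ((99/100) * (9869/1000) * (31415/10000) * (4/5)))" .
  have "1 / (pi\<^sup>2 * r) \<le> 1 / r * (1 / (9869/1000))"
    using r pi2 by (simp add: field_simps)
  then have "2 * integral {r..1/2} (\<lambda>x. (norm (?T x))\<^sup>2)
      \<le> 1 / r * (1 / (9869/1000)) + 1 / r * (1 / ((99/100) * (9869/1000) * (31415/10000) * (4/5)))"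
    using eq osc osc' gint(2) by linarith
  also have "\<dots> \<le> 1 / r * (143/1000)"
    unfolding distrib_left[symmetric] using r by (intro mult_left_mono) auto
  finally show ?thesis using arc_energy_reflect[of r "{lo..<lo + int n}"] r by simp
qed

text \<open>
  The best constant is the maximum over \<open>y\<close> of \<open>y (1 - I(y))\<close>, where \<open>I(y)\<close> is the integral of
  \<open>(sin (\<pi> x) / (\<pi> x))\<^sup>2\<close> over \<open>[-y, y]\<close>; it is about \<open>0.1367\<close>, attained near \<open>y = 0.31\<close>.
\<close>

lemma arc_energy_interval_ge:
  assumes "n \<ge> 1" "0 < r" "r \<le> 1 / 20"
  shows "arc_energy {lo..<lo + int n} r \<ge> real n - (143/1000) / r"
  using arc_energy_interval_ge_small[of n r lo] arc_energy_interval_ge_large[of n r lo] assms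
  by (cases "real n * r \<le> (4/5)") auto

subsection \<open>Sums of the sieve weights\<close>

text \<open>Exponent 0 gives \<open>sieve_L\<close>; the exponents 1/2 and 1 collect the relative
  losses \<open>sqrt (q / sqrt N)\<close> and \<open>q / sqrt N\<close> in the two energy
  bounds.\<close>

definition power_sum :: "(nat \<Rightarrow> real) \<Rightarrow> real \<Rightarrow> real \<Rightarrow> real" where
  "power_sum g p D = (\<Sum>q | 1 \<le> q \<and> real q \<le> D. g q * real q powr p)"

lemma finite_nat_le_real [simp]: "finite {q::nat. 1 \<le> q \<and> real q \<le> D}"
proof (rule finite_subset)
  show "{q::nat. 1 \<le> q \<and> real q \<le> D} \<subseteq> {..nat \<lfloor>D\<rfloor>}" by (auto simp: le_nat_floor)
qed simp

lemmas finite_nat_le_real' [simp] = finite_nat_le_real[unfolded One_nat_def]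

lemma power_sum_nonneg: "(\<And>q. g q \<ge> 0) \<Longrightarrow> power_sum g p D \<ge> 0"
  unfolding power_sum_def by (intro sum_nonneg) auto

lemma power_sum_mono: "(\<And>q. g q \<ge> 0) \<Longrightarrow> D \<le> D' \<Longrightarrow> power_sum g p D \<le> power_sum g p D'"
  unfolding power_sum_def by (intro sum_mono2) auto

lemma power_sum_step:
  assumes g: "\<And>q. g q \<ge> 0" and p: "p > 0" and D: "0 \<le> D'" "D' \<le> D"
  shows "power_sum g p D \<le> power_sum g p D' + D powr p * (power_sum g 0 D - power_sum g 0 D')"
proof -
  let ?A = "{q::nat. 1 \<le> q \<and> real q \<le> D'}" and ?B = "{q::nat. 1 \<le> q \<and> real q \<le> D \<and> \<not> real q \<le> D'}"
  have fin: "finite ?B" by (rule finite_subset[OF _ finite_nat_le_real[of D]]) auto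
  have split: "power_sum g r D = power_sum g r D' + (\<Sum>q\<in>?B. g q * real q powr r)" for r
  proof -
    have "{q::nat. 1 \<le> q \<and> real q \<le> D} = ?A \<union> ?B" using D by auto
    then show ?thesis unfolding power_sum_def using fin
      by (simp only:) (rule sum.union_disjoint, auto)
  qed
  have "(\<Sum>q\<in>?B. g q * real q powr p) \<le> (\<Sum>q\<in>?B. D powr p * (g q * real q powr 0))"
  proof (rule sum_mono)
    fix q assume "q \<in> ?B"
    then have "real q powr p \<le> D powr p" "real q powr 0 = 1" using p by (auto intro!: powr_mono2)
    then show "g q * real q powr p \<le> D powr p * (g q * real q powr 0)"
      using mult_left_mono[OF _ g[of q], of "real q powr p" "D powr p"] by (simp add: mult.commute)
  qed
  then show ?thesis using split[of p] split[of 0] by (simp add: sum_distrib_left)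
qed

text \<open>A substitute for partial summation: between \<open>D / l\<close> and \<open>D\<close>
  the factor \<open>q powr p\<close> is at most \<open>D powr p\<close>, and the successive blocks
  form a geometric series of ratio \<open>l powr - p\<close>. The last term accounts for the start
  below \<open>l * D0\<close>.\<close>

lemma power_sum_le:
  fixes g :: "nat \<Rightarrow> real"
  assumes g: "\<And>q. g q \<ge> 0" and p: "p > 0" and l: "l > 1" and k: "k \<ge> 1"
    and B: "B \<ge> 0" and D0: "D0 \<ge> 1"
    and step: "\<And>D. D \<ge> D0 \<Longrightarrow> power_sum g 0 D - power_sum g 0 (D / l) \<le> B * ln D powr (k - 1)"
    and D: "D \<ge> D0"
  shows "power_sum g p D \<le> B / (1 - l powr - p) * D powr p * ln D powr (k - 1) + power_sum g p (l * D0)"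
proof -
  define A where "A = B / (1 - l powr - p)"
  have lp: "l powr - p < 1" using l p by (simp add: powr_less_one)
  \<comment> \<open>\<open>A\<close> is the fixed point of the block recursion, which is what closes
    the induction on the number of blocks.\<close>
  then have A: "A \<ge> 0" "A * l powr - p + B = A" unfolding A_def using B by (auto simp: field_simps)
  have "\<forall>D. D0 \<le> D \<and> D \<le> D0 * l ^ n \<longrightarrow>
      power_sum g p D \<le> A * D powr p * ln D powr (k - 1) + power_sum g p (l * D0)" for n
  proof (induction n)
    case 0
    show ?case
    proof (intro allI impI)
      fix D assume "D0 \<le> D \<and> D \<le> D0 * l ^ 0"
      then have "power_sum g p D \<le> power_sum g p (l * D0)"
        using l D0 by (intro power_sum_mono g) (auto simp: mult_le_cancel_right1)
      moreover have "0 \<le> A * D powr p * ln D powr (k - 1)" using A by simp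
      ultimately show "power_sum g p D \<le> A * D powr p * ln D powr (k - 1) + power_sum g p (l * D0)" by simp
    qed
  next
    case (Suc n)
    show ?case
    proof (intro allI impI)
      fix D assume DD: "D0 \<le> D \<and> D \<le> D0 * l ^ Suc n"
      then have D1: "D \<ge> 1" using D0 by simp
      show "power_sum g p D \<le> A * D powr p * ln D powr (k - 1) + power_sum g p (l * D0)"
      proof (cases "D / l \<ge> D0")
        case False
        then have "D \<le> l * D0" using l by (simp add: field_simps)
        then have "power_sum g p D \<le> power_sum g p (l * D0)" by (intro power_sum_mono g)
        moreover have "0 \<le> A * D powr p * ln D powr (k - 1)" using A by simp
        ultimately show ?thesis by simp
      next
        case True
        have Dl: "D / l \<ge> 1" "D / l \<le> D"
          using True D0 l D1 by (linarith, simp add: divide_le_eq mult_le_cancel_left1)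
        have "power_sum g p (D / l) \<le> A * (D / l) powr p * ln (D / l) powr (k - 1) + power_sum g p (l * D0)"
          using Suc.IH True DD l by (auto simp: field_simps)
        also have "A * (D / l) powr p * ln (D / l) powr (k - 1) \<le> A * (D / l) powr p * ln D powr (k - 1)"
          using A Dl k by (intro mult_left_mono powr_mono2) auto
        also have "A * (D / l) powr p * ln D powr (k - 1) = A * l powr - p * (D powr p * ln D powr (k - 1))"
          using D1 l by (simp add: powr_divide powr_minus field_simps)
        finally have "power_sum g p (D / l) \<le> A * l powr - p * (D powr p * ln D powr (k - 1)) + power_sum g p (l * D0)"
          by simp
        moreover have "power_sum g p D \<le> power_sum g p (D / l) + D powr p * (power_sum g 0 D - power_sum g 0 (D / l))"
          using Dl by (intro power_sum_step g p) auto
        moreover have "D powr p * (power_sum g 0 D - power_sum g 0 (D / l)) \<le> D powr p * (B * ln D powr (k - 1))"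
          using DD by (intro mult_left_mono step) auto
        ultimately have "power_sum g p D \<le> (A * l powr - p + B) * (D powr p * ln D powr (k - 1)) + power_sum g p (l * D0)"
          by (simp add: algebra_simps)
        then show ?thesis unfolding A(2) by (simp add: mult.assoc)
      qed
    qed
  qed
  moreover obtain n where "D / D0 < l ^ n" using real_arch_pow[OF l] by blast
  then have "D \<le> D0 * l ^ n" using D0 by (simp add: field_simps)
  ultimately show ?thesis using D unfolding A_def by blast
qed

section \<open>Asymptotics on the logarithmic scale\<close>

lemma powr_shift_limit:
  fixes a k c C :: real
  shows "((\<lambda>s. (C * ((s + a) powr k + c * (s + a) powr (k - 1)) - C * s powr k) / s powr (k - 1))
     \<longlongrightarrow> C * (k * a + c)) at_top"
  by real_asymp

lemma powr_shift_ratio: "((\<lambda>s::real. (s + a) powr k / s powr k) \<longlongrightarrow> 1) at_top"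
  by real_asymp

lemma exp_shift_limit:
  fixes x p k A0 :: real
  assumes "x > 0" "p > 0"
  shows "((\<lambda>s::real. A0 / ((x * exp s) powr p * s powr k)) \<longlongrightarrow> 0) at_top"
  using assms by real_asymp


text \<open>For \<open>D = x * exp s\<close> one has \<open>ln D = s + ln x\<close>, and
  \<open>(s + ln x) powr k\<close> contributes an extra \<open>k * ln x\<close> at order
  \<open>s powr (k - 1)\<close>. Rescaling thus alters only the second coefficient.\<close>

lemma shift_limit:
  fixes L :: "real \<Rightarrow> real"
  assumes L: "(\<lambda>D. L D - C * (ln D powr k + c * ln D powr (k - 1))) \<in> o[at_top](\<lambda>D. ln D powr (k - 1))"
    and x: "x > 0"
  shows "((\<lambda>s. (L (x * exp s) - C * s powr k) / s powr (k - 1)) \<longlongrightarrow> C * (k * ln x + c)) at_top"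
proof -
  let ?R = "\<lambda>D. L D - C * (ln D powr k + c * ln D powr (k - 1))"
  have top: "filterlim (\<lambda>s. x * exp s) at_top at_top" using x by real_asymp
  have ln: "ln (x * exp s) = s + ln x" for s using x by (simp add: ln_mult)
  have "(\<lambda>s. ?R (x * exp s)) \<in> o[at_top](\<lambda>s. ln (x * exp s) powr (k - 1))"
    by (rule landau_o.small.compose[OF L top])
  then have "(\<lambda>s. ?R (x * exp s)) \<in> o[at_top](\<lambda>s. (s + ln x) powr (k - 1))"
    unfolding ln .
  then have "((\<lambda>s. ?R (x * exp s) / (s + ln x) powr (k - 1)) \<longlongrightarrow> 0) at_top"
    by (rule smalloD_tendsto)
  from tendsto_mult[OF this powr_shift_ratio[of "ln x" "k - 1"]]
  have "((\<lambda>s. ?R (x * exp s) / (s + ln x) powr (k - 1) * ((s + ln x) powr (k - 1) / s powr (k - 1))) \<longlongrightarrow> 0) at_top"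
    by simp
  moreover have "eventually (\<lambda>s. s + ln x > 0) at_top"
    by (rule eventually_mono[OF eventually_gt_at_top[of "- ln x"]]) auto
  then have "eventually (\<lambda>s. ?R (x * exp s) / (s + ln x) powr (k - 1) * ((s + ln x) powr (k - 1) / s powr (k - 1))
      = ?R (x * exp s) / s powr (k - 1)) at_top"
    by eventually_elim simp
  ultimately have "((\<lambda>s. ?R (x * exp s) / s powr (k - 1)) \<longlongrightarrow> 0) at_top"
    by (rule Lim_transform_eventually)
  from tendsto_add[OF this powr_shift_limit[of C "ln x" k c]]
  have "((\<lambda>s. ?R (x * exp s) / s powr (k - 1)
      + (C * ((s + ln x) powr k + c * (s + ln x) powr (k - 1)) - C * s powr k) / s powr (k - 1))
      \<longlongrightarrow> C * (k * ln x + c)) at_top" by simp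
  then show ?thesis unfolding ln add_divide_distrib[symmetric] by simp
qed

text \<open>The block ratio \<open>l\<close> is close to 1, with \<open>l powr p = 1 + d\<close>. A
  block carries about \<open>C * k * ln l * s powr (k - 1)\<close>, and division by
  \<open>1 - l powr - p\<close> yields \<open>C * k / p\<close> up to factors \<open>1 + d\<close>,
  the constant that partial summation predicts.\<close>

lemma eventually_power_sum_le:
  fixes g :: "nat \<Rightarrow> real"
  assumes g: "\<And>q. g q \<ge> 0" and k: "k \<ge> 1" and C: "C > 0"
    and L: "(\<lambda>D. power_sum g 0 D - C * (ln D powr k + c * ln D powr (k - 1))) \<in> o[at_top](\<lambda>D. ln D powr (k - 1))"
    and p: "p > 0" and x: "x > 0" and e: "e > 0"
  shows "eventually (\<lambda>s. power_sum g p (x * exp s) \<le> C * k / p * (1 + e) * (x * exp s) powr p * s powr (k - 1)) at_top"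
proof -
  define d where "d = min 1 (e / 8)"
  have d: "d > 0" "d \<le> 1" "d \<le> e / 8" using e by (auto simp: d_def)
  define l where "l = (1 + d) powr (1 / p)"
  have l: "l > 1" "l powr p = 1 + d" "ln l = ln (1 + d) / p"
    using d p by (auto simp: l_def powr_powr ln_powr intro!: gr_one_powr)
  define B where "B = C * k * ln l * (1 + d)"
  have lnl: "ln l > 0" using l(1) by simp
  have B: "B > 0" "C * k * ln l < B" unfolding B_def using C k lnl d by auto
  \<comment> \<open>The leading terms and the constant \<open>c\<close> cancel between
    \<open>exp s\<close> and \<open>exp s / l\<close>, leaving \<open>C * k * ln l\<close>.\<close>
  have "((\<lambda>s. (power_sum g 0 (1 * exp s) - C * s powr k) / s powr (k - 1)
       - (power_sum g 0 (1 / l * exp s) - C * s powr k) / s powr (k - 1))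
      \<longlongrightarrow> C * (k * ln 1 + c) - C * (k * ln (1 / l) + c)) at_top"
    using l by (intro tendsto_diff shift_limit L) auto
  moreover have "C * (k * ln 1 + c) - C * (k * ln (1 / l) + c) < B"
    using B l by (simp add: ln_div algebra_simps)
  ultimately have "eventually (\<lambda>s. (power_sum g 0 (1 * exp s) - C * s powr k) / s powr (k - 1)
       - (power_sum g 0 (1 / l * exp s) - C * s powr k) / s powr (k - 1) < B) at_top"
    by (rule order_tendstoD(2))
  then have "eventually (\<lambda>s. power_sum g 0 (exp s) - power_sum g 0 (exp s / l) \<le> B * s powr (k - 1)) at_top"
    using eventually_gt_at_top[of "0::real"]
  proof eventually_elim
    case (elim s)
    then have "s powr (k - 1) > 0" by simp
    then show ?case using elim(1) unfolding diff_divide_distrib[symmetric]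
      by (simp add: pos_divide_less_eq)
  qed
  then obtain s0 where s0: "\<And>s. s \<ge> s0 \<Longrightarrow> power_sum g 0 (exp s) - power_sum g 0 (exp s / l) \<le> B * s powr (k - 1)"
    unfolding eventually_at_top_linorder by blast
  define D0 where "D0 = exp (max s0 0)"
  have D0: "D0 \<ge> 1" unfolding D0_def by simp
  have step: "power_sum g 0 D - power_sum g 0 (D / l) \<le> B * ln D powr (k - 1)" if "D \<ge> D0" for D
  proof -
    have "D > 0" using that D0 by simp
    moreover have "ln D \<ge> s0" using that \<open>D > 0\<close> unfolding D0_def
      by (metis ln_exp ln_le_cancel_iff exp_gt_zero max.bounded_iff)
    ultimately show ?thesis using s0[of "ln D"] by simp
  qed
  define A where "A = B / (1 - l powr - p)"
  define A0 where "A0 = power_sum g p (l * D0)"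
  have "A = C * k / p * ln (1 + d) * (1 + d) / (1 - 1 / (1 + d))"
    unfolding A_def B_def using l by (simp add: powr_minus inverse_eq_divide)
  also have "\<dots> = C * k / p * (ln (1 + d) / d * (1 + d) * (1 + d))"
    using d by (simp add: field_simps)
  also have "\<dots> \<le> C * k / p * (1 * (1 + d) * (1 + d))"
    using ln_add_one_self_le_self2[of d] d C k p by (intro mult_left_mono mult_right_mono) (auto simp: field_simps)
  also have "\<dots> < C * k / p * (1 + e)"
  proof (rule mult_strict_left_mono)
    have "d * d \<le> d * 1" using d by (intro mult_left_mono) auto
    moreover have "1 * (1 + d) * (1 + d) = 1 + 2 * d + d * d" by (simp add: algebra_simps)
    ultimately show "1 * (1 + d) * (1 + d) < 1 + e" using d by linarith
  qed (use C k p in auto)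
  finally have AL: "A < C * k / p * (1 + e)" .
  have "((\<lambda>s. A * ((s + ln x) powr (k - 1) / s powr (k - 1)) + A0 / ((x * exp s) powr p * s powr (k - 1)))
      \<longlongrightarrow> A * 1 + 0) at_top"
    by (intro tendsto_add tendsto_mult tendsto_const powr_shift_ratio exp_shift_limit x p)
  then have "eventually (\<lambda>s. A * ((s + ln x) powr (k - 1) / s powr (k - 1)) + A0 / ((x * exp s) powr p * s powr (k - 1))
      < C * k / p * (1 + e)) at_top"
    using AL by (intro order_tendstoD(2)) auto
  moreover have "eventually (\<lambda>s. x * exp s \<ge> D0) at_top"
  proof -
    have "filterlim (\<lambda>s. x * exp s) at_top at_top" using x by real_asymp
    then show ?thesis by (simp add: filterlim_at_top)
  qed
  ultimately show ?thesis using eventually_gt_at_top[of "0::real"]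
  proof eventually_elim
    case (elim s)
    have pos: "(x * exp s) powr p * s powr (k - 1) > 0" using x elim(3) by simp
    have "power_sum g p (x * exp s) \<le> A * (x * exp s) powr p * ln (x * exp s) powr (k - 1) + A0"
      unfolding A_def A0_def
      by (rule power_sum_le[OF g p l(1) k _ D0 step elim(2)]) (use B in auto)
    also have "ln (x * exp s) = s + ln x" using x by (simp add: ln_mult)
    also have "A * (x * exp s) powr p * (s + ln x) powr (k - 1) + A0
       = (A * ((s + ln x) powr (k - 1) / s powr (k - 1)) + A0 / ((x * exp s) powr p * s powr (k - 1)))
         * ((x * exp s) powr p * s powr (k - 1))"
      using pos elim(3) x by (simp add: distrib_right)
    also have "\<dots> \<le> C * k / p * (1 + e) * ((x * exp s) powr p * s powr (k - 1))"
      using elim(1) pos by (intro mult_right_mono) auto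
    finally show ?case by (simp add: mult.assoc)
  qed
qed

subsection \<open>The sieve bound\<close>

text \<open>Widening by \<open>H\<close> costs a relative \<open>H / N\<close>, the kernel tail
  costs \<open>1 / (H * r)\<close>, of order \<open>q * sqrt N / H\<close>. They balance at
  \<open>H\<close> near \<open>N * v\<close> with \<open>v = sqrt (q / sqrt N)\<close>; the losses
  \<open>5 * v\<close> and \<open>16 / 3 * v\<close> together stay below \<open>11 * v\<close>. When
  \<open>11 * v\<close> is at least 1, positivity of the energy suffices.\<close>

lemma arc_energy_ge_sqrt:
  assumes Z: "Z \<subseteq> {M..M + int N}" and N: "N \<ge> 1" and q: "1 \<le> q"
    and r: "r = 1 / (2 * real q * (4 / 3 * sqrt (real N)))" "r \<le> 1 / 2"
  shows "arc_energy Z r \<ge> (real (card Z))\<^sup>2 / real N * (1 - 11 * sqrt (real q / sqrt (real N)))"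
proof -
  define b v P where "b = sqrt (real N)" and "v = sqrt (real q / b)" and "P = real (card Z)"
  have b: "b \<ge> 1" "b\<^sup>2 = real N" using N by (simp_all add: b_def)
  have v: "v > 0" "v\<^sup>2 = real q / b" using q b by (simp_all add: v_def)
  \<comment> \<open>This absorbs the rounding in \<open>H\<close>: \<open>2 * H + 1\<close> is then
    at most \<open>5 * N * v\<close>.\<close>
  have Nv: "real N * v \<ge> 1"
  proof -
    have "(real N * v)\<^sup>2 = (b\<^sup>2)\<^sup>2 * (real q / b)" unfolding power_mult_distrib v(2) b(2) ..
    also have "\<dots> = b ^ 3 * real q" using b(1) by (simp add: eval_nat_numeral)
    also have "\<dots> \<ge> 1" using b q mult_mono[of 1 "b ^ 3" 1 "real q"] by simp
    finally have "1\<^sup>2 \<le> (real N * v)\<^sup>2" by simp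
    then show ?thesis using v N power2_le_imp_le[of 1 "real N * v"] by simp
  qed
  show ?thesis
  proof (cases "11 * v \<ge> 1")
    case True
    then have "P\<^sup>2 / real N * (1 - 11 * v) \<le> 0" by (intro mult_nonneg_nonpos) auto
    then show ?thesis using arc_energy_nonneg[of Z r] unfolding P_def v_def b_def by linarith
  next
    case False
    define H where "H = nat \<lceil>real N * v\<rceil>"
    have H: "real N * v \<le> real H" "real H \<le> real N * v + 1"
      unfolding H_def using Nv by linarith+
    then have H1: "H \<ge> 1" using Nv by simp
    have r0: "r > 0" "1 / r = 8 / 3 * real q * b" unfolding r b_def[symmetric] using q b by auto
    have "2 / (real H * r) = 2 / real H * (8 / 3 * real q * b)" unfolding r0(2)[symmetric] by simp
    also have "\<dots> \<le> 2 / (real N * v) * (8 / 3 * real q * b)"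
      using H Nv b by (intro mult_right_mono divide_left_mono) auto
    also have "\<dots> = 16 / 3 * v"
    proof -
      have "real q = v\<^sup>2 * b" using v b by simp
      then show ?thesis using v b b(2)[symmetric] by (simp add: power2_eq_square)
    qed
    finally have h: "2 / (real H * r) \<le> 16 / 3 * v" .
    have n': "real (N + 2 * H + 1) \<le> real N * (1 + 5 * v)"
      using H Nv by (simp add: algebra_simps)
    have N0: "real N > 0" using N by simp
    have "1 - 11 * v \<le> (1 - 5 * v) * (1 - 16 / 3 * v)"
    proof -
      have "(1 - 5 * v) * (1 - 16 / 3 * v) = 1 - 31 / 3 * v + 80 / 3 * v\<^sup>2"
        by (simp add: power2_eq_square field_simps)
      then show ?thesis using v(1) zero_le_power2[of v] by linarith
    qed
    also have "\<dots> \<le> 1 / (1 + 5 * v) * (1 - 16 / 3 * v)"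
    proof (rule mult_right_mono)
      have "(1 - 5 * v) * (1 + 5 * v) \<le> 1" by (simp add: algebra_simps)
      then show "1 - 5 * v \<le> 1 / (1 + 5 * v)" using v by (simp add: pos_le_divide_eq)
    qed (use False in auto)
    finally have "P\<^sup>2 / real N * (1 - 11 * v) \<le> P\<^sup>2 / real N * (1 / (1 + 5 * v) * (1 - 16 / 3 * v))"
      by (intro mult_left_mono) auto
    also have "\<dots> = P\<^sup>2 / (real N * (1 + 5 * v)) * (1 - 16 / 3 * v)" by simp
    also have "\<dots> \<le> P\<^sup>2 / real (N + 2 * H + 1) * (1 - 2 / (real H * r))"
      using n' h False N0 v by (intro mult_mono divide_left_mono mult_pos_pos) auto
    also have "\<dots> \<le> arc_energy Z r"
      unfolding P_def by (rule arc_energy_ge[OF Z r0(1) r(2) H1])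
    finally show ?thesis unfolding P_def v_def b_def .
  qed
qed

text \<open>Here \<open>H\<close> is near \<open>N * t^2\<close> and the perturbation parameter is
  \<open>t\<close>. The energy bound at \<open>s\<close> makes the discrepancy at most
  \<open>10 * t^2\<close> times \<open>P^2 / N\<close>, which costs \<open>10 * t\<close> after
  division by \<open>t\<close>; the factors \<open>1 - t\<close> and \<open>N / n'\<close> cost
  another \<open>2 * t\<close>. The slope 143/375 is \<open>2 * 0.143 * 4 / 3\<close>.\<close>

lemma arc_energy_ge_linear:
  assumes Z: "Z \<subseteq> {M..M + int N}" and t: "0 < t" "t \<le> 1 / 100" and N: "real N \<ge> 3 / t\<^sup>2"
    and s: "s = 1 / (2 * (t ^ 4 * sqrt (real N)) * (4 / 3 * sqrt (real N)))" "s \<le> 1 / 2"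
    and small: "arc_energy Z s \<le> (1 + t\<^sup>2) * ((real (card Z))\<^sup>2 / real N)"
    and q: "t ^ 4 * sqrt (real N) \<le> real q" "real q \<le> 4 / 3 * sqrt (real N)" "1 \<le> q"
    and r: "r = 1 / (2 * real q * (4 / 3 * sqrt (real N)))" "r \<le> 1 / 20"
  shows "arc_energy Z r \<ge> (real (card Z))\<^sup>2 / real N * (1 - 143 / 375 * (real q / sqrt (real N)) - 12 * t)"
proof -
  define b P E where "b = sqrt (real N)" and "P = real (card Z)" and "E = P\<^sup>2 / real N"
  have t2: "0 < t\<^sup>2" "t\<^sup>2 \<le> t / 100" "t\<^sup>2 \<le> 1 / 10000"
    using t mult_mono[of t "1/100" t "1/100"] by (auto simp: power2_eq_square)
  have Nt: "real N * t\<^sup>2 \<ge> 3" using N t2 by (simp add: field_simps)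
  have N0: "real N > 0" using Nt t2 by (metis le_less_trans mult_zero_left not_less of_nat_0_less_iff
        not_gr_zero of_nat_0 zero_less_numeral)
  have b: "b > 0" "b\<^sup>2 = real N" using N0 by (simp_all add: b_def)
  define H where "H = nat \<lceil>real N * t\<^sup>2\<rceil>"
  have H: "real N * t\<^sup>2 \<le> real H" "real H \<le> real N * t\<^sup>2 + 1"
    unfolding H_def using Nt by linarith+
  then have H1: "H \<ge> 1" using Nt by simp
  define n' where "n' = real (N + 2 * H + 1)"
  have n': "real N \<le> n'" "n' \<le> real N * (1 + 3 * t\<^sup>2)"
    using H Nt by (simp_all add: n'_def algebra_simps)
  have n0: "n' > 0" using n' N0 by simp
  have E: "E \<ge> 0" unfolding E_def by simp
  have r0: "r > 0" "1 / r = 8 / 3 * real q * b" unfolding r b_def[symmetric] using q b by auto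
  have s0: "s > 0" "1 / s = 8 / 3 * t ^ 4 * b\<^sup>2"
  proof -
    have "0 < 2 * (t ^ 4 * b) * (4 / 3 * b)"
      using t(1) b(1) by (intro mult_pos_pos zero_less_power) auto
    then show "s > 0" unfolding s b_def[symmetric] by (rule divide_pos_pos[OF zero_less_one])
    show "1 / s = 8 / 3 * t ^ 4 * b\<^sup>2" unfolding s b_def[symmetric] by (simp add: power2_eq_square)
  qed
  have rs: "r \<le> s"
  proof -
    have "0 < 2 * (t ^ 4 * b) * (4 / 3 * b)"
      using t(1) b(1) by (intro mult_pos_pos zero_less_power) auto
    moreover have "2 * (t ^ 4 * b) * (4 / 3 * b) \<le> 2 * real q * (4 / 3 * b)"
      using q b unfolding b_def[symmetric] by (intro mult_right_mono mult_left_mono) auto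
    ultimately show ?thesis unfolding r s b_def[symmetric] by (intro frac_le) auto
  qed
  \<comment> \<open>The radius \<open>s\<close> belongs to denominators of size
    \<open>t ^ 4 * sqrt N\<close>. The fourth power is chosen so that, divided by the
    \<open>t^2\<close> in \<open>H\<close>, it leaves a kernel tail of order
    \<open>t^2\<close>.\<close>
  have "2 / (real H * s) = 2 / real H * (8 / 3 * t ^ 4 * real N)"
    unfolding b(2)[symmetric] s0(2)[symmetric] by simp
  also have "\<dots> \<le> 2 / (real N * t\<^sup>2) * (8 / 3 * t ^ 4 * real N)"
    using H Nt t N0 by (intro mult_right_mono divide_left_mono) auto
  also have "\<dots> = 16 / 3 * t\<^sup>2" using t N0 by (simp add: eval_nat_numeral)
  finally have h: "2 / (real H * s) \<le> 16 / 3 * t\<^sup>2" .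
  have inv: "1 - 3 * t\<^sup>2 \<le> real N / n'"
  proof -
    have "(1 - 3 * t\<^sup>2) * n' \<le> (1 - 3 * t\<^sup>2) * (real N * (1 + 3 * t\<^sup>2))"
      using n' t2 by (intro mult_left_mono) auto
    also have "\<dots> = real N * (1 - 9 * (t\<^sup>2)\<^sup>2)" by (simp add: power2_eq_square algebra_simps)
    also have "\<dots> \<le> real N * 1" using N0 by (intro mult_left_mono) auto
    finally show ?thesis using n0 by (simp add: pos_le_divide_eq)
  qed
  have "(1 - 3 * t\<^sup>2) * (1 - 16 / 3 * t\<^sup>2) \<le> real N / n' * (1 - 2 / (real H * s))"
    using inv h t2 n0 by (intro mult_mono) auto
  then have "E * ((1 - 3 * t\<^sup>2) * (1 - 16 / 3 * t\<^sup>2)) \<le> E * (real N / n' * (1 - 2 / (real H * s)))"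
    using E by (intro mult_left_mono)
  also have "\<dots> = P\<^sup>2 / n' * (1 - 2 / (real H * s))"
    unfolding E_def using N0 by simp
  finally have "arc_energy Z s - P\<^sup>2 / n' * (1 - 2 / (real H * s))
      \<le> (1 + t\<^sup>2) * E - E * ((1 - 3 * t\<^sup>2) * (1 - 16 / 3 * t\<^sup>2))"
    using small unfolding E_def P_def by linarith
  also have "\<dots> = E * (28 / 3 * t\<^sup>2 - 16 * (t\<^sup>2)\<^sup>2)"
    by (simp add: power2_eq_square field_simps)
  also have "\<dots> \<le> E * (10 * t\<^sup>2)"
    using t2 E by (intro mult_left_mono) (auto intro: order_trans[of _ "28 / 3 * t\<^sup>2"])
  finally have "(1 / t) * (arc_energy Z s - P\<^sup>2 / n' * (1 - 2 / (real H * s))) \<le> (1 / t) * (E * (10 * t\<^sup>2))"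
    using t by (intro mult_left_mono) auto
  also have "\<dots> = E * (10 * t)" using t by (simp add: power2_eq_square)
  finally have X: "(1 / t) * (arc_energy Z s - P\<^sup>2 / n' * (1 - 2 / (real H * s))) \<le> E * (10 * t)" .
  define c where "c = 143 / 375 * (real q / b)"
  have c: "0 \<le> c" "c \<le> 1"
    using q b unfolding c_def b_def[symmetric] by (auto simp: field_simps)
  have T: "arc_energy (widen M N H) r \<ge> n' * (1 - c)"
  proof -
    have "widen M N H = {M - int H..<M - int H + int (N + 2 * H + 1)}"
      unfolding widen_def by auto
    then have "arc_energy (widen M N H) r \<ge> n' - (143/1000) / r"
      unfolding n'_def using arc_energy_interval_ge[of "N + 2 * H + 1" r "M - int H"] r0 r(2) by simp
    moreover have "(143/1000) / r = real N * c"
    proof -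
      have "(143/1000) / r = (143/1000) * (8 / 3 * real q * b)" unfolding r0(2)[symmetric] by simp
      then show ?thesis using b unfolding c_def b(2)[symmetric] by (simp add: power2_eq_square)
    qed
    moreover have "real N * c \<le> n' * c" using n' c by (intro mult_right_mono)
    ultimately show ?thesis by (simp add: algebra_simps)
  qed
  have "E * ((1 - 2 * t) * (1 - c)) \<le> E * ((1 - t) * (1 - 3 * t\<^sup>2) * (1 - c))"
  proof (intro mult_left_mono mult_right_mono E)
    have "(1 - t) * (1 - 3 * t\<^sup>2) = 1 - t - 3 * t\<^sup>2 + 3 * (t * t\<^sup>2)" by (simp add: algebra_simps)
    moreover have "0 \<le> t * t\<^sup>2" using t by (intro mult_nonneg_nonneg) auto
    ultimately show "1 - 2 * t \<le> (1 - t) * (1 - 3 * t\<^sup>2)" using t t2 by linarith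
  qed (use c in auto)
  also have "\<dots> \<le> E * ((1 - t) * (real N / n') * (1 - c))"
    using inv t c by (intro mult_left_mono mult_right_mono E) auto
  also have "\<dots> = (1 - t) * (P / n')\<^sup>2 * (n' * (1 - c))"
    unfolding E_def using N0 n0 by (simp add: power2_eq_square)
  also have "\<dots> \<le> (1 - t) * (P / n')\<^sup>2 * arc_energy (widen M N H) r"
    using T t by (intro mult_left_mono) auto
  finally have "E * ((1 - 2 * t) * (1 - c)) - E * (10 * t) \<le> arc_energy Z r"
    using arc_energy_ge_interval[OF Z r0(1) rs s(2) H1, of t] t X
    unfolding P_def[symmetric] n'_def[symmetric] by linarith
  moreover have "E * (1 - c - 12 * t) \<le> E * ((1 - 2 * t) * (1 - c)) - E * (10 * t)"
  proof -
    have "(1 - 2 * t) * (1 - c) - 10 * t = (1 - c - 12 * t) + 2 * (t * c)" by (simp add: algebra_simps)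
    moreover have "0 \<le> t * c" using t c by simp
    ultimately have "E * (1 - c - 12 * t) \<le> E * ((1 - 2 * t) * (1 - c) - 10 * t)"
      using E by (intro mult_left_mono) auto
    then show ?thesis by (simp add: right_diff_distrib)
  qed
  ultimately show ?thesis unfolding E_def P_def c_def b_def by linarith
qed


text \<open>
  Either the set is so unevenly spread that one arc already carries too much energy, and then all
  wider arcs do, or it is close to an interval in mean square on all narrower arcs.
\<close>

lemma sieve_dichotomy:
  assumes K: "residue_sets K" "consistent_sets K" "johnsen_gallagher K"
    and Z: "Z \<subseteq> {M..M + int N}" and supp: "has_support K (4 / 3 * sqrt (real N)) Z"
    and t: "0 < t" "t \<le> 1 / 100" and N: "real N \<ge> 3 / t\<^sup>2" "t ^ 4 * sqrt (real N) \<ge> 10"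
  defines "g \<equiv> sieve_g K" and "b \<equiv> sqrt (real N)" and "E \<equiv> (real (card Z))\<^sup>2 / real N"
  shows "(1 + t\<^sup>2) * E * power_sum g 0 (t ^ 4 * b) \<le> real (card Z) \<or>
     E * (power_sum g 0 (4 / 3 * b) - 11 * (power_sum g (1 / 2) (t ^ 4 * b) / sqrt b)
       - 143 / 375 * (power_sum g 1 (4 / 3 * b) / b)
       - 12 * t * (power_sum g 0 (4 / 3 * b) - power_sum g 0 (t ^ 4 * b))) \<le> real (card Z)"
proof -
  define Q u where "Q = 4 / 3 * b" and "u = t ^ 4 * b"
  let ?A = "{q::nat. 1 \<le> q \<and> real q \<le> u}" and ?C = "{q::nat. 1 \<le> q \<and> real q \<le> Q}"
  define a where "a q = arc_energy Z (1 / (2 * real q * Q))" for q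
  have fin: "finite Z" using Z by (rule finite_subset) simp
  have g0: "g q \<ge> 0" for q unfolding g_def by (rule sieve_g_nonneg[OF K])
  have t4: "t ^ 4 \<le> 1" "t ^ 4 > 0" using t by (auto intro: power_le_one)
  have b: "b \<ge> 10"
    using N(2) t4 mult_right_mono[of "t ^ 4" 1 b] unfolding b_def by simp
  have N1: "N \<ge> 1" using b unfolding b_def by (cases N) auto
  have uQ: "u \<le> Q" "u \<ge> 10" "Q \<ge> 10"
    using t4 b N(2) mult_right_mono[of "t ^ 4" "4/3" b] unfolding u_def Q_def b_def[symmetric] by auto
  have AC: "?A \<subseteq> ?C" using uQ by auto
  have a0: "a q \<ge> 0" for q unfolding a_def by (rule arc_energy_nonneg)
  have total: "(\<Sum>q\<in>?C. g q * a q) \<le> real (card Z)"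
    unfolding g_def a_def using supp uQ
    by (intro sum_sieve_g_arc_energy_le K fin) (auto simp: Q_def b_def)
  have rad: "1 / (2 * real q * Q) \<le> 1 / 20" if "1 \<le> q" for q
  proof -
    have "10 \<le> real q * Q" using mult_mono[of 1 "real q" 10 Q] that uQ by simp
    then show ?thesis unfolding mult.assoc by (intro frac_le) linarith+
  qed
  \<comment> \<open>Since \<open>u\<close> is a real threshold, \<open>s\<close> need not be the
    radius of any arc in the sum; it separates the wider arcs, with \<open>q\<close> up to
    \<open>u\<close>, from the narrower ones.\<close>
  define s where "s = 1 / (2 * u * Q)"
  have s: "s \<le> 1 / 2"
  proof -
    have "10 \<le> u * Q" using mult_mono[of 1 u 10 Q] uQ by simp
    then show ?thesis unfolding s_def mult.assoc by (intro frac_le) linarith+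
  qed
  show ?thesis
  proof (cases "arc_energy Z s \<le> (1 + t\<^sup>2) * E")
    case False
    have "(1 + t\<^sup>2) * E * power_sum g 0 u = (\<Sum>q\<in>?A. g q * ((1 + t\<^sup>2) * E))"
      unfolding power_sum_def sum_distrib_left by (rule sum.cong) auto
    also have "\<dots> \<le> (\<Sum>q\<in>?A. g q * a q)"
    proof (intro sum_mono mult_left_mono g0)
      fix q assume q: "q \<in> ?A"
      then have "s \<le> 1 / (2 * real q * Q)"
        unfolding s_def using uQ by (intro divide_left_mono mult_mono mult_pos_pos) auto
      then show "(1 + t\<^sup>2) * E \<le> a q"
        using False arc_energy_mono[of s "1 / (2 * real q * Q)" Z] unfolding a_def by linarith
    qed
    also have "\<dots> \<le> (\<Sum>q\<in>?C. g q * a q)"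
      using AC g0 a0 by (intro sum_mono2) auto
    finally show ?thesis using total unfolding u_def by linarith
  next
    case True
    have small: "E * (1 - 11 * (real q powr (1 / 2) / sqrt b)) \<le> a q" if "q \<in> ?A" for q
    proof -
      have q: "1 \<le> q" using that by simp
      have "arc_energy Z (1 / (2 * real q * Q)) \<ge> E * (1 - 11 * sqrt (real q / b))"
        unfolding E_def b_def using rad[OF q]
        by (intro arc_energy_ge_sqrt[OF Z N1 q]) (auto simp: Q_def b_def)
      then show ?thesis unfolding a_def by (simp add: real_sqrt_divide powr_half_sqrt)
    qed
    have large: "E * (1 - 143 / 375 * (real q powr 1 / b) - 12 * t) \<le> a q" if "q \<in> ?C - ?A" for q
    proof -
      have q: "1 \<le> q" "t ^ 4 * sqrt (real N) \<le> real q" "real q \<le> 4 / 3 * sqrt (real N)"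
        using that unfolding u_def Q_def b_def by auto
      have "arc_energy Z (1 / (2 * real q * Q)) \<ge> E * (1 - 143 / 375 * (real q / b) - 12 * t)"
        unfolding E_def b_def
        by (rule arc_energy_ge_linear[OF Z t N(1) _ _ _ q(2,3,1)])
          (use True s rad[OF q(1)] in \<open>simp_all only: s_def u_def Q_def b_def E_def\<close>)
      then show ?thesis unfolding a_def using q by simp
    qed
    define G where "G p = (\<Sum>q\<in>?C - ?A. g q * real q powr p)" for p
    have G: "power_sum g p Q = power_sum g p u + G p" for p
      unfolding power_sum_def G_def using sum.subset_diff[OF AC finite_nat_le_real] by (simp add: add.commute)
    have "E * (power_sum g 0 u - 11 * (power_sum g (1 / 2) u / sqrt b))
        = (\<Sum>q\<in>?A. g q * (E * (1 - 11 * (real q powr (1 / 2) / sqrt b))))"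
      unfolding power_sum_def sum_distrib_left sum_divide_distrib sum_subtractf[symmetric]
      by (rule sum.cong) (auto simp: algebra_simps)
    also have "\<dots> \<le> (\<Sum>q\<in>?A. g q * a q)"
      using small by (intro sum_mono mult_left_mono g0)
    finally have 1: "E * (power_sum g 0 u - 11 * (power_sum g (1 / 2) u / sqrt b)) \<le> (\<Sum>q\<in>?A. g q * a q)" .
    have "E * (G 0 - 143 / 375 * (G 1 / b) - 12 * t * G 0)
        = (\<Sum>q\<in>?C - ?A. g q * (E * (1 - 143 / 375 * (real q powr 1 / b) - 12 * t)))"
      unfolding G_def sum_distrib_left sum_divide_distrib sum_subtractf[symmetric]
      by (rule sum.cong) (auto simp: algebra_simps)
    also have "\<dots> \<le> (\<Sum>q\<in>?C - ?A. g q * a q)"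
      using large by (intro sum_mono mult_left_mono g0)
    finally have 2: "E * (G 0 - 143 / 375 * (G 1 / b) - 12 * t * G 0) \<le> (\<Sum>q\<in>?C - ?A. g q * a q)" .
    \<comment> \<open>The loss linear in \<open>q\<close> is charged to the wider arcs as well, so
      that its sum runs over all \<open>q\<close> up to \<open>Q\<close>; this only lowers the
      bound.\<close>
    have 3: "E * (143 / 375 * (power_sum g 1 u / b)) \<ge> 0"
      unfolding E_def using power_sum_nonneg[of g 1 u] g0 b by simp
    have "E * (power_sum g 0 Q - 11 * (power_sum g (1 / 2) u / sqrt b) - 143 / 375 * (power_sum g 1 Q / b)
         - 12 * t * (power_sum g 0 Q - power_sum g 0 u))
       = E * (power_sum g 0 u - 11 * (power_sum g (1 / 2) u / sqrt b))
         + E * (G 0 - 143 / 375 * (G 1 / b) - 12 * t * G 0) - E * (143 / 375 * (power_sum g 1 u / b))"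
      unfolding G[of 0] G[of 1] by (simp add: algebra_simps add_divide_distrib)
    also have "\<dots> \<le> (\<Sum>q\<in>?A. g q * a q) + (\<Sum>q\<in>?C - ?A. g q * a q)"
      using 1 2 3 by linarith
    also have "\<dots> = (\<Sum>q\<in>?C. g q * a q)"
      using sum.subset_diff[OF AC finite_nat_le_real, of "\<lambda>q. g q * a q"] by (simp only: add.commute)
    finally show ?thesis using total unfolding u_def Q_def by linarith
  qed
qed

section \<open>Numerical constants and the main term\<close>

lemma sieve_L_eq: "sieve_L K D = power_sum (sieve_g K) 0 D"
  unfolding sieve_L_def power_sum_def by (rule sum.cong) auto

lemma ln_four_thirds: "ln (4 / 3 :: real) \<ge> 2876 / 10000"
  using ln_approx_bounds[of "4 / 3" 2] by (simp add: eval_nat_numeral)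

text \<open>The left side is \<open>20 * ln 10\<close>, and 10 is below \<open>(13 / 8) ^ 6\<close>,
  which is at most \<open>exp 3\<close>.\<close>

lemma ln_tiny: "- ln ((1 / 100000) ^ 4 :: real) \<le> 60"
proof -
  have "ln (10::real) \<le> 3"
  proof -
    have "(1 + 1 / 2 + (1 / 2)\<^sup>2 / 2 :: real) \<le> exp (1 / 2)" by (rule exp_lower_Taylor_quadratic) simp
    then have "(13 / 8 :: real) ^ 6 \<le> exp (1 / 2) ^ 6"
      by (intro power_mono) (auto simp: power2_eq_square)
    also have "exp (1 / 2 :: real) ^ 6 = exp 3" by (simp flip: exp_of_nat_mult)
    finally have "(10::real) \<le> exp 3" by (simp add: eval_nat_numeral)
    then show ?thesis using ln_le_cancel_iff[of 10 "exp 3 :: real"] by simp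
  qed
  moreover have "ln (100000::real) = 5 * ln 10" using ln_realpow[of "10::real" 5] by simp
  ultimately show ?thesis by (simp add: ln_realpow ln_div)
qed

text \<open>Both alternatives of the dichotomy have to reach \<open>R s\<close>, where
  \<open>exp s\<close> stands for \<open>sqrt N\<close>. In the first, the gain
  \<open>t^2 * C * s powr k\<close> eventually outweighs the loss from \<open>ln (t ^ 4)\<close> at
  the next order. In the second, \<open>ln (4 / 3)\<close> less about 0.509 leaves more than -0.222
  as the coefficient of \<open>C * k\<close>, and the terms in \<open>t\<close> and \<open>h\<close>
  fit into the slack down to -0.238.\<close>

lemma eventually_main_term:
  fixes g :: "nat \<Rightarrow> real"
  assumes C: "C > 0" and k: "k \<ge> 1" and g: "\<And>q. g q \<ge> 0"
    and L: "(\<lambda>D. power_sum g 0 D - C * (ln D powr k + c * ln D powr (k - 1))) \<in> o[at_top](\<lambda>D. ln D powr (k - 1))"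
  defines "t \<equiv> 1 / 100000" and "R \<equiv> \<lambda>s. C * (s powr k + (c - 0.238 * k) * s powr (k - 1))"
  shows "eventually (\<lambda>s. R s > 0 \<and> R s \<le> (1 + t\<^sup>2) * power_sum g 0 (t ^ 4 * exp s) \<and>
     R s \<le> power_sum g 0 (4 / 3 * exp s) - 11 * (power_sum g (1 / 2) (t ^ 4 * exp s) / sqrt (exp s))
       - 143 / 375 * (power_sum g 1 (4 / 3 * exp s) / exp s)
       - 12 * t * (power_sum g 0 (4 / 3 * exp s) - power_sum g 0 (t ^ 4 * exp s))) at_top"
proof -
  have t: "t > 0" "t ^ 4 > 0" by (simp_all add: t_def)
  define h where "h = C / 1000"
  have h: "h > 0" using C by (simp add: h_def)
  define T where "T = C * (k * ln (t ^ 4) + c)"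
  define V where "V = C * (k * ln (4 / 3) + c)"
  have limT: "((\<lambda>s. (power_sum g 0 (t ^ 4 * exp s) - C * s powr k) / s powr (k - 1)) \<longlongrightarrow> T) at_top"
    unfolding T_def by (rule shift_limit[OF L t(2)])
  have limV: "((\<lambda>s. (power_sum g 0 (4 / 3 * exp s) - C * s powr k) / s powr (k - 1)) \<longlongrightarrow> V) at_top"
    unfolding V_def by (rule shift_limit[OF L]) simp
  have ev1: "eventually (\<lambda>s. (power_sum g 0 (t ^ 4 * exp s) - C * s powr k) / s powr (k - 1) > T - h) at_top"
    using h by (intro order_tendstoD(1)[OF limT]) simp
  have ev2: "eventually (\<lambda>s. (power_sum g 0 (4 / 3 * exp s) - C * s powr k) / s powr (k - 1) > V - h) at_top"
    using h by (intro order_tendstoD(1)[OF limV]) simp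
  have ev3: "eventually (\<lambda>s. (power_sum g 0 (4 / 3 * exp s) - C * s powr k) / s powr (k - 1) < V + h) at_top"
    using h by (intro order_tendstoD(2)[OF limV]) simp
  have ev4: "eventually (\<lambda>s. power_sum g 1 (4 / 3 * exp s) \<le> C * k / 1 * (1 + 1 / 1000) * (4 / 3 * exp s) powr 1 * s powr (k - 1)) at_top"
    by (rule eventually_power_sum_le[OF g k C L]) auto
  have ev5: "eventually (\<lambda>s. power_sum g (1 / 2) (t ^ 4 * exp s) \<le> C * k / (1 / 2) * (1 + 1 / 1000) * (t ^ 4 * exp s) powr (1 / 2) * s powr (k - 1)) at_top"
    by (rule eventually_power_sum_le[OF g k C L]) (use t in auto)
  \<comment> \<open>From \<open>S\<close> on, \<open>t^2 * C * s\<close> covers the deficit of the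
    lower-order coefficients in the first alternative.\<close>
  define S where "S = (C * (c - 0.238 * k) - (1 + t\<^sup>2) * (T - h)) / (t\<^sup>2 * C)"
  show ?thesis
    using ev1 ev2 ev3 ev4 ev5 eventually_gt_at_top[of "0::real"]
      eventually_gt_at_top[of "0.238 * k - c"] eventually_ge_at_top[of S]
  proof eventually_elim
    case (elim s)
    define E where "E = s powr (k - 1)"
    have E: "E > 0" unfolding E_def using elim(6) by simp
    have sE: "s powr k = s * E" unfolding E_def using elim(6) by (simp add: powr_diff)
    define A B W Y where "A = power_sum g 0 (t ^ 4 * exp s)" and "B = power_sum g 0 (4 / 3 * exp s)"
      and "W = power_sum g 1 (4 / 3 * exp s) / exp s"
      and "Y = power_sum g (1 / 2) (t ^ 4 * exp s) / sqrt (exp s)"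
    have R: "R s = C * (s + (c - 0.238 * k)) * E" unfolding R_def sE E_def[symmetric] by (simp add: algebra_simps)
    have A: "(C * s + (T - h)) * E \<le> A"
      using elim(1) E unfolding A_def[symmetric] E_def[symmetric] sE by (simp add: field_simps)
    have B: "(C * s + (V - h)) * E \<le> B" "B \<le> (C * s + (V + h)) * E"
      using elim(2,3) E unfolding B_def[symmetric] E_def[symmetric] sE by (simp_all add: field_simps)
    have W: "W \<le> C * k * (1001 / 750) * E"
      using elim(4) unfolding W_def E_def[symmetric] by (simp add: pos_divide_le_eq mult_ac)
    have Y: "Y \<le> C * k * (2002 / 1000 * t\<^sup>2) * E"
    proof -
      have "(t ^ 4 * exp s) powr (1 / 2) = t\<^sup>2 * sqrt (exp s)"
      proof -
        have "sqrt (t ^ 4) = t\<^sup>2" by (rule real_sqrt_unique) (simp_all flip: power_mult)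
        then show ?thesis using t by (simp add: powr_half_sqrt real_sqrt_mult)
      qed
      then show ?thesis
        using elim(5) unfolding Y_def E_def[symmetric] by (simp add: pos_divide_le_eq mult_ac)
    qed
    have "R s > 0" unfolding R using C E elim(7) by simp
    moreover have "R s \<le> (1 + t\<^sup>2) * A"
    proof -
      have "C * (c - 0.238 * k) - (1 + t\<^sup>2) * (T - h) \<le> s * (t\<^sup>2 * C)"
        using elim(8) C t unfolding S_def by (simp add: pos_divide_le_eq)
      then have "C * (s + (c - 0.238 * k)) \<le> (1 + t\<^sup>2) * (C * s + (T - h))"
        by (simp add: algebra_simps)
      then have "R s \<le> (1 + t\<^sup>2) * (C * s + (T - h)) * E"
        unfolding R using E by (intro mult_right_mono) auto
      also have "\<dots> \<le> (1 + t\<^sup>2) * A"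
        unfolding mult.assoc using A by (intro mult_left_mono) auto
      finally show ?thesis .
    qed
    moreover have "R s \<le> B - 11 * Y - 143 / 375 * W - 12 * t * (B - A)"
    proof -
      have "C * (s + (c - 0.238 * k)) \<le> (C * s + (V - h)) - 11 * (C * k * (2002 / 1000 * t\<^sup>2))
         - 143 / 375 * (C * k * (1001 / 750)) - 12 * t * ((V + h) - (T - h))"
      proof -
        have V: "V = C * k * ln (4 / 3) + C * c" and T: "T = C * k * ln (t ^ 4) + C * c"
          unfolding V_def T_def by (simp_all add: algebra_simps)
        have Rs: "C * (s + (c - 0.238 * k)) = C * s + C * c - 238 / 1000 * (C * k)"
          by (simp add: algebra_simps)
        have tt: "12 * t = 12 / 100000" "t\<^sup>2 = 1 / 10000000000"
          by (simp_all add: t_def power2_eq_square)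
        have "C * k * ln (4 / 3) \<ge> C * k * (2876 / 10000)"
          using C k ln_four_thirds by (intro mult_left_mono) auto
        moreover have "C * k * (ln (4 / 3) - ln (t ^ 4)) \<le> C * k * 61"
          using C k ln_tiny ln_le_minus_one[of "4 / 3 :: real"] unfolding t_def
          by (intro mult_left_mono) auto
        moreover have "C * k * (ln (4 / 3) - ln (t ^ 4)) = C * k * ln (4 / 3) - C * k * ln (t ^ 4)"
          by (rule right_diff_distrib)
        moreover have "C * 1 \<le> C * k" "0 \<le> C * k" using C k by (auto intro: mult_left_mono)
        \<comment> \<open>A linear inequality in \<open>u = C * s\<close>, \<open>w = C * c\<close>,
          \<open>a = C * k\<close>, \<open>d = C\<close>, \<open>x = C * k * ln (4 / 3)\<close> and
          \<open>y = C * k * ln (t ^ 4)\<close>. That \<open>k\<close> is at least 1 enters as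
          \<open>d\<close> at most \<open>a\<close>, which absorbs the errors
          \<open>h\<close>.\<close>
        moreover have "u + w - 238 / 1000 * a
            \<le> u + (x + w - d / 1000) - 11 * (a * (2002 / 1000 * (1 / 10000000000)))
              - 143 / 375 * (a * (1001 / 750)) - 12 / 100000 * (x + w + d / 1000 - (y + w - d / 1000))"
          if "a * (2876 / 10000) \<le> x" "x - y \<le> a * 61" "d * 1 \<le> a" "0 \<le> a" for u w a x y d :: real
          using that by (simp add: field_simps)
        ultimately show ?thesis unfolding V T Rs h_def tt by (simp only:)
      qed
      then have "R s \<le> ((C * s + (V - h)) - 11 * (C * k * (2002 / 1000 * t\<^sup>2))
         - 143 / 375 * (C * k * (1001 / 750)) - 12 * t * ((V + h) - (T - h))) * E"
        unfolding R using E by (intro mult_right_mono) auto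
      also have "\<dots> = (C * s + (V - h)) * E - 11 * (C * k * (2002 / 1000 * t\<^sup>2) * E)
         - 143 / 375 * (C * k * (1001 / 750) * E) - 12 * t * ((C * s + (V + h)) * E - (C * s + (T - h)) * E)"
        by (simp add: algebra_simps)
      also have "\<dots> \<le> B - 11 * Y - 143 / 375 * W - 12 * t * (B - A)"
      proof -
        have "12 * t * (B - A) \<le> 12 * t * ((C * s + (V + h)) * E - (C * s + (T - h)) * E)"
          using A B t by (intro mult_left_mono) auto
        then show ?thesis using B(1) W Y by linarith
      qed
      finally show ?thesis .
    qed
    ultimately show ?case unfolding A_def B_def W_def Y_def by simp
  qed
qed


theorem theorem1p5:
  fixes K :: "nat \<Rightarrow> int set" and C \<kappa> c\<^sub>0 :: real
  assumes "residue_sets K"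
    and "multiplicative_sets K"
    and "consistent_sets K"
    and "johnsen_gallagher K"
    and "C > 0" and "\<kappa> \<ge> 1"
    and "(\<lambda>D::real. sieve_L K D - C * (ln D powr \<kappa> + c\<^sub>0 * ln D powr (\<kappa> - 1)))
           \<in> o[at_top](\<lambda>D. ln D powr (\<kappa> - 1))"
    and "\<exists>B::real. \<forall>D\<ge>1. \<bar>prime_power_sum K D - \<kappa> * D\<bar> \<le> B * (D / ln (2 * D))"
    and "\<exists>B::real. \<forall>D\<ge>1. \<bar>prime_power_pair_sum K D\<bar> \<le> B * sqrt D"
  shows "\<exists>N\<^sub>0::nat. \<forall>N\<ge>N\<^sub>0. \<forall>M::int. \<forall>Z::int set.
           Z \<subseteq> {M..M + int N} \<longrightarrow>
           (\<forall>Q::real. Q \<le> pi * sqrt (real N) / 2 \<longrightarrow> has_support K Q Z) \<longrightarrow>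
           real (card Z) \<le> 2 powr \<kappa> * real N /
             (C * (ln (real N) powr \<kappa> + 2 * (c\<^sub>0 - 0.238 * \<kappa>) * ln (real N) powr (\<kappa> - 1)))"
proof -
  note K = assms(1,3,4)
  define g where "g = sieve_g K"
  have g: "g q \<ge> 0" for q unfolding g_def by (rule sieve_g_nonneg[OF K])
  define t :: real where "t = 1 / 100000"
  define R where "R s = C * (s powr \<kappa> + (c\<^sub>0 - 0.238 * \<kappa>) * s powr (\<kappa> - 1))" for s :: real
  define X where "X b = power_sum g 0 (4 / 3 * b) - 11 * (power_sum g (1 / 2) (t ^ 4 * b) / sqrt b)
       - 143 / 375 * (power_sum g 1 (4 / 3 * b) / b)
       - 12 * t * (power_sum g 0 (4 / 3 * b) - power_sum g 0 (t ^ 4 * b))" for b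
  have ev: "eventually (\<lambda>s. R s > 0 \<and> R s \<le> (1 + t\<^sup>2) * power_sum g 0 (t ^ 4 * exp s) \<and> R s \<le> X (exp s)) at_top"
    using eventually_main_term[OF assms(5,6) g assms(7)[unfolded sieve_L_eq, folded g_def]]
    unfolding R_def X_def t_def .
  have "filterlim (\<lambda>N::nat. ln (real N) / 2) at_top at_top" by real_asymp
  \<comment> \<open>The substitution \<open>s = ln N / 2\<close> makes
    \<open>exp s = sqrt N\<close>; the explicit threshold yields both size conditions of the
    dichotomy.\<close>
  from eventually_compose_filterlim[OF ev this] eventually_ge_at_top[of "nat \<lceil>(10 / t ^ 4)\<^sup>2\<rceil>"]
  have "eventually (\<lambda>N::nat. \<forall>M::int. \<forall>Z::int set. Z \<subseteq> {M..M + int N} \<longrightarrow>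
           (\<forall>Q::real. Q \<le> pi * sqrt (real N) / 2 \<longrightarrow> has_support K Q Z) \<longrightarrow>
           real (card Z) \<le> 2 powr \<kappa> * real N /
             (C * (ln (real N) powr \<kappa> + 2 * (c\<^sub>0 - 0.238 * \<kappa>) * ln (real N) powr (\<kappa> - 1)))) at_top"
  proof eventually_elim
    case (elim N)
    have NN: "real N \<ge> (10 / t ^ 4)\<^sup>2" using elim(2) by linarith
    then have sqrtN: "sqrt (real N) \<ge> 10 / t ^ 4" by (rule real_le_rsqrt)
    have N: "real N \<ge> 3 / t\<^sup>2" "t ^ 4 * sqrt (real N) \<ge> 10"
      using NN sqrtN by (simp_all add: t_def field_simps)
    have N0: "real N > 1" using N(1) by (simp add: t_def power2_eq_square)
    define s where "s = ln (real N) / 2"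
    have s: "exp s = sqrt (real N)" "s > 0" "ln (real N) = 2 * s"
      unfolding s_def using N0 by (simp_all add: powr_half_sqrt[symmetric] powr_def)
    have main: "R s > 0" "R s \<le> (1 + t\<^sup>2) * power_sum g 0 (t ^ 4 * sqrt (real N))" "R s \<le> X (sqrt (real N))"
      using elim(1) unfolding s_def[symmetric] s(1) by auto
    \<comment> \<open>As \<open>ln N = 2 * s\<close>, the two powers produce
      \<open>2 powr \<kappa>\<close> and \<open>2 powr (\<kappa> - 1)\<close>; the factor 2 in front
      of the second coefficient makes up the difference.\<close>
    have den: "C * (ln (real N) powr \<kappa> + 2 * (c\<^sub>0 - 0.238 * \<kappa>) * ln (real N) powr (\<kappa> - 1)) = 2 powr \<kappa> * R s"
      unfolding s(3) R_def using s(2) by (simp add: powr_mult powr_diff algebra_simps)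
    show ?case
    proof (intro allI impI)
      fix M :: int and Z :: "int set"
      assume Z: "Z \<subseteq> {M..M + int N}" and supp: "\<forall>Q::real. Q \<le> pi * sqrt (real N) / 2 \<longrightarrow> has_support K Q Z"
      define P where "P = real (card Z)"
      \<comment> \<open>The value 4/3 is close to \<open>1 / (2 * sqrt 0.143)\<close>, where
        \<open>ln U - 2 * 0.143 * U^2\<close> is largest, and it is below
        \<open>pi / 2\<close>.\<close>
      have "3 * sqrt (real N) \<le> pi * sqrt (real N)"
        using pi_gt3 by (intro mult_right_mono) auto
      moreover have "sqrt (real N) \<ge> 0" by simp
      ultimately have "4 / 3 * sqrt (real N) \<le> pi * sqrt (real N) / 2" by linarith
      then have "has_support K (4 / 3 * sqrt (real N)) Z" using supp by blast
      from sieve_dichotomy[OF K Z this _ _ N]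
      have dich: "(1 + t\<^sup>2) * (P\<^sup>2 / real N) * power_sum g 0 (t ^ 4 * sqrt (real N)) \<le> P \<or>
         P\<^sup>2 / real N * X (sqrt (real N)) \<le> P"
        unfolding g_def[symmetric] P_def X_def by (simp add: t_def)
      have P0: "P\<^sup>2 / real N \<ge> 0" by simp
      have "P\<^sup>2 / real N * R s \<le> P"
        using dich
      proof
        assume *: "(1 + t\<^sup>2) * (P\<^sup>2 / real N) * power_sum g 0 (t ^ 4 * sqrt (real N)) \<le> P"
        have "P\<^sup>2 / real N * R s \<le> P\<^sup>2 / real N * ((1 + t\<^sup>2) * power_sum g 0 (t ^ 4 * sqrt (real N)))"
          by (rule mult_left_mono[OF main(2) P0])
        also have "\<dots> = (1 + t\<^sup>2) * (P\<^sup>2 / real N) * power_sum g 0 (t ^ 4 * sqrt (real N))"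
          by (simp only: mult_ac)
        finally show ?thesis using * by linarith
      next
        assume *: "P\<^sup>2 / real N * X (sqrt (real N)) \<le> P"
        have "P\<^sup>2 / real N * R s \<le> P\<^sup>2 / real N * X (sqrt (real N))"
          by (rule mult_left_mono[OF main(3) P0])
        then show ?thesis using * by linarith
      qed
      then have "P * (P * R s) \<le> P * real N"
        using N0 by (simp add: pos_divide_le_eq power2_eq_square mult_ac)
      moreover have "P \<ge> 0" by (simp add: P_def)
      ultimately have "P * R s \<le> real N"
        using main(1) N0 by (cases "P = 0") auto
      then have "P \<le> real N / R s" using main(1) by (simp add: pos_le_divide_eq)
      also have "\<dots> = 2 powr \<kappa> * real N / (2 powr \<kappa> * R s)" by simp
      finally show "real (card Z) \<le> 2 powr \<kappa> * real N /
             (C * (ln (real N) powr \<kappa> + 2 * (c\<^sub>0 - 0.238 * \<kappa>) * ln (real N) powr (\<kappa> - 1)))"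
        unfolding den P_def .
    qed
  qed
  then show ?thesis unfolding eventually_at_top_linorder .
qed

end
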